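(* Let $\bm{\xi}^1,\dots,\bm{\xi}^N\in\mathbb{R}^d$ be the available samples, $\bar{\bm{\xi}}=\frac1N\sum_{k=1}^N\bm{\xi}^k$, and $\hat{\mathbb{P}}$ the centered empirical distribution. For any $\rho>0$, the Wasserstein distributionally robust control policy $\mathbf{K}^\star_{\mathrm{dr}}$ that solves $$\min_{\mathbf{K}\in\mathcal{K}}\ \sup_{\mathbb{P}\in\mathbb{B}^\rho_{\mathbb{W}}(\hat{\mathbb{P}})}J(\mathbf{K},\mathbb{P})$$ is given by $$\mathbf{K}^\star_{\mathrm{dr}}=\bm{\Phi}^{\mathrm{dr}}_{uy}-\bm{\Phi}^{\mathrm{dr}}_{ux}\left(\bm{\Phi}^{\mathrm{dr}}_{xx}\right)^{-1}\bm{\Phi}^{\mathrm{dr}}_{xy},$$ where $\bm{\Phi}^{\mathrm{dr}}_{xx},\bm{\Phi}^{\mathrm{dr}}_{xy},\bm{\Phi}^{\mathrm{dr}}_{ux},\bm{\Phi}^{\mathrm{dr}}_{uy}$ are the corresponding components of a solution to the following convex optimization problem in the variables $\lambda\in\mathbb{R}$, $s_1,\dots,s_N\in\mathbb{R}$, $\bm{\nu}\in\mathbb{R}^d$, symmetric $\mathbf{P}\in\mathbb{R}^{d\times d}$, and $\bm{\Phi}_{xx},\bm{\Phi}_{xy},\bm{\Phi}_{ux},\bm{\Phi}_{uy}$: $$\inf\ \lambda\rho^2+\frac1N\sum_{k=1}^Ns_k$$ subject to $\lambda\ge0$, achievability of $(\bm{\Phi}_{xx},\bm{\Phi}_{xy},\bm{\Phi}_{ux},\bm{\Phi}_{uy})$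 (as defined in the context), $$\begin{bmatrix}\lambda\mathbf{I}-\mathbf{P}&-\frac12\bm{\nu}+\lambda(\bm{\xi}^k-\bar{\bm{\xi}})\\ \left(-\frac12\bm{\nu}+\lambda(\bm{\xi}^k-\bar{\bm{\xi}})\right)^\top&s_k+\lambda\|\bm{\xi}^k-\bar{\bm{\xi}}\|^2\end{bmatrix}\succeq0\quad\text{for all }k\in\{1,\dots,N\},$$ $$\begin{bmatrix}\mathbf{I}&\mathbf{S}^{1/2}\begin{bmatrix}\bm{\Phi}_{xx}&\bm{\Phi}_{xy}\\\bm{\Phi}_{ux}&\bm{\Phi}_{uy}\end{bmatrix}\\ \left(\mathbf{S}^{1/2}\begin{bmatrix}\bm{\Phi}_{xx}&\bm{\Phi}_{xy}\\\bm{\Phi}_{ux}&\bm{\Phi}_{uy}\end{bmatrix}\right)^\top&\mathbf{P}\end{bmatrix}\succeq0,$$ where $\mathbf{S}=\operatorname{blkdiag}(\mathbf{Q},\mathbf{R})$.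
   Context: System. Fix a horizon $T\in\mathbb{N}$ and matrices $A_t,B_t,C_t$ of sizes $n\times n$, $n\times m$, $p\times n$. The dynamics are $x_{t+1}=A_tx_t+B_tu_t+w_t$, $y_t=C_tx_t+v_t$. Write $\mathbf{x}=(x_0,\dots,x_{T-1})$, $\mathbf{u}=(u_0,\dots,u_{T-1})$, $\mathbf{y}=(y_0,\dots,y_{T-1})$, $\mathbf{w}=(x_0,w_0,\dots,w_{T-2})$, $\mathbf{v}=(v_0,\dots,v_{T-1})$, and $\bm{\xi}=(\mathbf{w},\mathbf{v})\in\mathbb{R}^d$, $d=(n+p)T$. With $\mathbf{A}=\operatorname{blkdiag}(A_0,\dots,A_{T-1})$, $\mathbf{B}=\operatorname{blkdiag}(B_0,\dots,B_{T-1})$, $\mathbf{C}=\operatorname{blkdiag}(C_0,\dots,C_{T-1})$ and $\mathbf{Z}$ the block-downshift matrix (identity $n\times n$ blocks on the first block sub-diagonal, zeros elsewhere), the dynamics read $\mathbf{x}=\mathbf{Z}\mathbf{A}\mathbf{x}+\mathbf{Z}\mathbf{B}\mathbf{u}+\mathbf{w}$, $\mathbf{y}=\mathbf{C}\mathbf{x}+\mathbf{v}$. Controllers. $\mathcal{K}$ is the set of lower block-triangular (causal) matrices $\mathbf{K}$ of size $mT\times pT$ (with $m\times p$ blocks); controller $\mathbf{K}\in\mathcal{K}$ applies $\mathbf{u}=\mathbf{K}\mathbf{y}$, so that $\mathbf{x}$ and $\mathbf{u}$ are linear functions of $\bm{\xi}$. Achievability. Matrices $\bm{\Phi}_{xx},\bm{\Phi}_{xy},\bm{\Phi}_{ux},\bm{\Phi}_{uy}$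 (sizes $nT\times nT$, $nT\times pT$, $mT\times nT$, $mT\times pT$) are achievable if they are causal (lower block-triangular) and satisfy $$\begin{bmatrix}\mathbf{I}-\mathbf{Z}\mathbf{A}&-\mathbf{Z}\mathbf{B}\end{bmatrix}\begin{bmatrix}\bm{\Phi}_{xx}&\bm{\Phi}_{xy}\\\bm{\Phi}_{ux}&\bm{\Phi}_{uy}\end{bmatrix}=\begin{bmatrix}\mathbf{I}&\mathbf{0}\end{bmatrix},\qquad\begin{bmatrix}\bm{\Phi}_{xx}&\bm{\Phi}_{xy}\\\bm{\Phi}_{ux}&\bm{\Phi}_{uy}\end{bmatrix}\begin{bmatrix}\mathbf{I}-\mathbf{Z}\mathbf{A}\\-\mathbf{C}\end{bmatrix}=\begin{bmatrix}\mathbf{I}\\\mathbf{0}\end{bmatrix}.$$ Cost. Fix symmetric matrices $\mathbf{Q}\succeq0$ and $\mathbf{R}\succ0$ of sizes $nT$ and $mT$. Let $\mathcal{P}$ be the set of zero mean probability distributions on $\mathbb{R}^d$. For $\mathbb{P}\in\mathcal{P}$, $J(\mathbf{K},\mathbb{P})=\mathbb{E}_{\mathbb{P}}[\mathbf{x}^\top\mathbf{Q}\mathbf{x}+\mathbf{u}^\top\mathbf{R}\mathbf{u}]$ where $\bm{\xi}\sim\mathbb{P}$ and $\mathbf{u}=\mathbf{K}\mathbf{y}$. Centered empirical law: $\hat{\mathbb{P}}=\frac1N\sum_{k=1}^N\delta(\bm{\xi}^k-\bar{\bm{\xi}})$, where $\delta(\cdot)$ denotes a Dirac mass at the given point. Ambiguity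 set: $\mathbb{W}$ is the 2-Wasserstein distance on $\mathbb{R}^d$ with Euclidean ground norm, and $\mathbb{B}^\rho_{\mathbb{W}}(\hat{\mathbb{P}})=\{\mathbb{P}\in\mathcal{P}:\mathbb{W}(\hat{\mathbb{P}},\mathbb{P})\le\rho\}$. *)

theory Defs
  imports "HOL-Probability.Probability"
begin

text \<open>
  The horizon is an arbitrary finite linearly ordered type \<open>'t\<close>, so \<open>T = CARD('t)\<close> and the time
  points \<open>0, \<dots>, T - 1\<close> are its elements in increasing order. A stacked signal with values in
  \<open>real^'n\<close> is a vector over \<open>'t \<times> 'n\<close>; the disturbance \<open>\<xi> = (w, v)\<close> is a vector over
  \<open>('t \<times> 'n) + ('t \<times> 'p)\<close>, whose dimension is \<open>d = (n + p) T\<close>.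
\<close>

section \<open>Block matrices\<close>

definition block_row :: "real^'b^'a \<Rightarrow> real^'c^'a \<Rightarrow> real^('b::finite + 'c::finite)^'a" where
  "block_row M N = (\<chi> i j. case j of Inl b \<Rightarrow> M $ i $ b | Inr c \<Rightarrow> N $ i $ c)"

definition block_col :: "real^'c^'a \<Rightarrow> real^'c^'b \<Rightarrow> real^'c^('a::finite + 'b::finite)" where
  "block_col M N = (\<chi> i. case i of Inl a \<Rightarrow> M $ a | Inr b \<Rightarrow> N $ b)"

definition block_mat ::
  "real^'c^'a \<Rightarrow> real^'d^'a \<Rightarrow> real^'c^'b \<Rightarrow> real^'d^'b \<Rightarrow> real^('c::finite + 'd::finite)^('a::finite + 'b::finite)" where
  "block_mat M11 M12 M21 M22 = block_col (block_row M11 M12) (block_row M21 M22)"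

definition blkdiag :: "('t::finite \<Rightarrow> real^'b::finite^'a::finite) \<Rightarrow> real^('t \<times> 'b)^('t \<times> 'a)" where
  "blkdiag M = (\<chi> i j. if fst i = fst j then M (fst i) $ snd i $ snd j else 0)"

definition causal :: "real^('t::{finite,linorder} \<times> 'b::finite)^('t \<times> 'a::finite) \<Rightarrow> bool" where
  "causal M \<longleftrightarrow> (\<forall>t s i j. t < s \<longrightarrow> M $ (t, i) $ (s, j) = 0)"

definition next_time :: "'t::linorder \<Rightarrow> 't \<Rightarrow> bool" where
  "next_time s t \<longleftrightarrow> s < t \<and> \<not> (\<exists>r. s < r \<and> r < t)"

definition downshift :: "real^('t::{finite,linorder} \<times> 'n::finite)^('t \<times> 'n)" where
  "downshift = (\<chi> i j. if next_time (fst j) (fst i) \<and> snd i = snd j then 1 else 0)"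

lemma downshift_next:
  assumes "next_time s t"
  shows "(downshift *v x) $ (t, i) = x $ (s, i)"
proof -
  have "downshift $ (t, i) $ j * x $ j = (if j = (s, i) then x $ j else 0)" for j
    using assms by (cases j) (auto simp: downshift_def next_time_def dest: antisym_conv3)
  then show ?thesis by (simp add: matrix_vector_mult_def)
qed

lemma downshift_first:
  assumes "\<And>s. \<not> s < t"
  shows "(downshift *v x) $ (t, i) = 0"
  using assms by (simp add: downshift_def matrix_vector_mult_def next_time_def)

lemma blkdiag_vec: "(blkdiag M *v x) $ (t, i) = (M t *v (\<chi> j. x $ (t, j))) $ i"
proof -
  have "(blkdiag M *v x) $ (t, i) =
      (\<Sum>j\<in>UNIV \<times> UNIV. (if t = fst j then M t $ i $ snd j else 0) * x $ j)"
    by (simp add: blkdiag_def matrix_vector_mult_def, intro sum.cong) auto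
  also have "\<dots> = (\<Sum>s\<in>UNIV. \<Sum>j\<in>UNIV. (if t = s then M t $ i $ j else 0) * x $ (s, j))"
    by (simp add: sum.cartesian_product split_def)
  also have "\<dots> = (\<Sum>s\<in>UNIV. if t = s then (\<Sum>j\<in>UNIV. M t $ i $ j * x $ (s, j)) else 0)"
    by (intro sum.cong refl) auto
  finally show ?thesis
    by (simp add: matrix_vector_mult_def)
qed

definition psd :: "real^'a^'a \<Rightarrow> bool" where
  "psd M \<longleftrightarrow> transpose M = M \<and> (\<forall>x. 0 \<le> x \<bullet> (M *v x))"

definition pos_def :: "real^'a^'a \<Rightarrow> bool" where
  "pos_def M \<longleftrightarrow> transpose M = M \<and> (\<forall>x. x \<noteq> 0 \<longrightarrow> 0 < x \<bullet> (M *v x))"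

definition psd_sqrt :: "real^'a^'a \<Rightarrow> real^'a^'a" where
  "psd_sqrt M = (THE L. psd L \<and> L ** L = M)"

section \<open>Closed loop and achievable system responses\<close>

definition state_noise :: "real^(('t::finite \<times> 'n::finite) + ('t \<times> 'p::finite)) \<Rightarrow> real^('t \<times> 'n)" where
  "state_noise \<xi> = (\<chi> i. \<xi> $ Inl i)"

definition output_noise :: "real^(('t::finite \<times> 'n::finite) + ('t \<times> 'p::finite)) \<Rightarrow> real^('t \<times> 'p)" where
  "output_noise \<xi> = (\<chi> i. \<xi> $ Inr i)"

text \<open>The initial state \<open>x\<^sub>0\<close> is the first block of \<^term>\<open>state_noise \<xi>\<close>.\<close>

definition closed_loop ::
  "('t::{finite,linorder} \<Rightarrow> real^'n::finite^'n) \<Rightarrow> ('t \<Rightarrow> real^'m::finite^'n) \<Rightarrow>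
   ('t \<Rightarrow> real^'n^'p::finite) \<Rightarrow>
   real^('t \<times> 'p)^('t \<times> 'm) \<Rightarrow> real^(('t \<times> 'n) + ('t \<times> 'p)) \<Rightarrow>
   real^('t \<times> 'n) \<Rightarrow> real^('t \<times> 'm) \<Rightarrow> bool" where
  "closed_loop A B C K \<xi> x u \<longleftrightarrow>
     x = (downshift ** blkdiag A) *v x + (downshift ** blkdiag B) *v u + state_noise \<xi> \<and>
     u = K *v (blkdiag C *v x + output_noise \<xi>)"

text \<open>For causal \<open>K\<close> the trajectory exists and is unique, see \<open>closed_loop_unique\<close> below.\<close>

definition trajectory ::
  "('t::{finite,linorder} \<Rightarrow> real^'n::finite^'n) \<Rightarrow> ('t \<Rightarrow> real^'m::finite^'n) \<Rightarrow>
   ('t \<Rightarrow> real^'n^'p::finite) \<Rightarrow>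
   real^('t \<times> 'p)^('t \<times> 'm) \<Rightarrow> real^(('t \<times> 'n) + ('t \<times> 'p)) \<Rightarrow>
   (real^('t \<times> 'n)) \<times> (real^('t \<times> 'm))" where
  "trajectory A B C K \<xi> = (THE (x, u). closed_loop A B C K \<xi> x u)"

lemma closed_loop_unique:
  fixes A :: "'t::{finite,linorder} \<Rightarrow> real^'n::finite^'n"
    and B :: "'t \<Rightarrow> real^'m::finite^'n"
    and C :: "'t \<Rightarrow> real^'n^'p::finite"
  assumes K: "causal K"
  shows "\<exists>!z. case z of (x, u) \<Rightarrow> closed_loop A B C K \<xi> x u"
proof -
  let ?w = "state_noise \<xi>" and ?v = "output_noise \<xi>"
  define M where "M = mat 1 - downshift ** blkdiag A - downshift ** blkdiag B ** K ** blkdiag C"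
  have Mv: "M *v x = x - (downshift ** blkdiag A) *v x
      - (downshift ** blkdiag B) *v (K *v (blkdiag C *v x))" for x
    by (simp add: M_def matrix_vector_mult_diff_rdistrib matrix_vector_mul_assoc matrix_mul_assoc)
  have shift0: "(downshift *v y) $ (t, i) = 0" if "\<And>s j. s < t \<Longrightarrow> y $ (s, j) = 0"
    for y :: "real^('t \<times> 'n)" and t i
    unfolding downshift_def matrix_vector_mult_def using that
    by (auto simp: next_time_def intro!: sum.neutral)
  have K0: "(K *v y) $ (t, i) = 0" if y: "\<And>s j. s \<le> t \<Longrightarrow> y $ (s, j) = 0" for y t i
  proof -
    have "K $ (t, i) $ j * y $ j = 0" for j
      using K y by (cases j; cases "t < fst j") (auto simp: causal_def not_less)
    then show ?thesis unfolding matrix_vector_mult_def by (simp only: vec_lambda_beta sum.neutral_const)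
  qed
  have blk0: "(blkdiag N *v y) $ (t, i) = 0" if "\<And>j. y $ (t, j) = 0"
    for N :: "'t \<Rightarrow> real^'g::finite^'h::finite" and y t i
    unfolding blkdiag_vec using that by (simp add: matrix_vector_mult_def)
  have zero: "x = 0" if x: "M *v x = 0" for x
  proof -
    have eq: "x = downshift *v (blkdiag A *v x)
        + downshift *v (blkdiag B *v (K *v (blkdiag C *v x)))"
      using x by (simp add: Mv matrix_vector_mul_assoc matrix_mul_assoc algebra_simps)
    have "\<forall>i. x $ (t, i) = 0" for t
    proof (induction "card {..<t}" arbitrary: t rule: less_induct)
      case less
      have prev: "x $ (s, i) = 0" if "s < t" for s i
      proof -
        have "{..<s} \<subset> {..<t}" using that by auto
        then have "card {..<s} < card {..<t}" by (intro psubset_card_mono) auto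
        then show ?thesis using less by blast
      qed
      have 1: "(blkdiag A *v x) $ (s, i) = 0" if "s < t" for s i
        by (intro blk0 prev that)
      have 2: "(blkdiag B *v (K *v (blkdiag C *v x))) $ (s, i) = 0" if "s < t" for s i
        by (intro blk0 K0 prev) (use that in auto)
      show ?case
        by (subst eq) (simp add: shift0 1 2)
    qed
    then show ?thesis by (simp add: vec_eq_iff split_paired_all)
  qed
  have "inj ((*v) M)"
    using zero by (auto simp: linear_injective_0)
  moreover from this have "surj ((*v) M)"
    by (intro linear_injective_imp_surjective matrix_vector_mul_linear refl)
  ultimately have "bij ((*v) M)"
    by (rule bijI)
  then have ex1: "\<exists>!x. M *v x = (downshift ** blkdiag B) *v (K *v ?v) + ?w"
    unfolding bij_iff by blast
  have cl: "closed_loop A B C K \<xi> x u \<longleftrightarrow>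
      M *v x = (downshift ** blkdiag B) *v (K *v ?v) + ?w \<and> u = K *v (blkdiag C *v x + ?v)" for x u
    unfolding closed_loop_def Mv
    by (auto simp: matrix_vector_right_distrib algebra_simps)
  show ?thesis
    using ex1 by (auto simp: cl)
qed

definition achievable ::
  "('t::{finite,linorder} \<Rightarrow> real^'n::finite^'n) \<Rightarrow> ('t \<Rightarrow> real^'m::finite^'n) \<Rightarrow>
   ('t \<Rightarrow> real^'n^'p::finite) \<Rightarrow>
   real^('t \<times> 'n)^('t \<times> 'n) \<Rightarrow> real^('t \<times> 'p)^('t \<times> 'n) \<Rightarrow>
   real^('t \<times> 'n)^('t \<times> 'm) \<Rightarrow> real^('t \<times> 'p)^('t \<times> 'm) \<Rightarrow> bool" where
  "achievable A B C \<Phi>xx \<Phi>xy \<Phi>ux \<Phi>uy \<longleftrightarrow>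
     causal \<Phi>xx \<and> causal \<Phi>xy \<and> causal \<Phi>ux \<and> causal \<Phi>uy \<and>
     block_row (mat 1 - downshift ** blkdiag A) (- (downshift ** blkdiag B)) **
       block_mat \<Phi>xx \<Phi>xy \<Phi>ux \<Phi>uy = block_row (mat 1) 0 \<and>
     block_mat \<Phi>xx \<Phi>xy \<Phi>ux \<Phi>uy **
       block_col (mat 1 - downshift ** blkdiag A) (- blkdiag C) = block_col (mat 1) 0"

section \<open>Distributionally robust control problem\<close>

definition zero_mean_probs :: "'a::euclidean_space measure set" where
  "zero_mean_probs = {P. prob_space P \<and> sets P = sets borel \<and>
     integrable P (\<lambda>\<xi>. \<xi>) \<and> (\<integral>\<xi>. \<xi> \<partial>P) = 0}"

definition couplings :: "'a measure \<Rightarrow> 'b measure \<Rightarrow> ('a \<times> 'b) measure set" where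
  "couplings \<mu> \<nu> = {\<gamma>. sets \<gamma> = sets (\<mu> \<Otimes>\<^sub>M \<nu>) \<and> distr \<gamma> \<mu> fst = \<mu> \<and> distr \<gamma> \<nu> snd = \<nu>}"

definition ennreal_sqrt :: "ennreal \<Rightarrow> ennreal" where
  "ennreal_sqrt a = (if a = \<top> then \<top> else ennreal (sqrt (enn2real a)))"

definition wasserstein2 :: "'a::euclidean_space measure \<Rightarrow> 'a measure \<Rightarrow> ennreal" where
  "wasserstein2 \<mu> \<nu> =
     ennreal_sqrt (INF \<gamma>\<in>couplings \<mu> \<nu>. \<integral>\<^sup>+z. ennreal ((norm (fst z - snd z))\<^sup>2) \<partial>\<gamma>)"

definition wasserstein_ball :: "real \<Rightarrow> 'a::euclidean_space measure \<Rightarrow> 'a measure set" where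
  "wasserstein_ball \<rho> \<mu> = {P \<in> zero_mean_probs. wasserstein2 \<mu> P \<le> ennreal \<rho>}"

definition centered :: "('k::finite \<Rightarrow> 'a::real_vector) \<Rightarrow> 'k \<Rightarrow> 'a" where
  "centered \<xi> k = \<xi> k - (1 / real CARD('k)) *\<^sub>R (\<Sum>l\<in>UNIV. \<xi> l)"

text \<open>
  The average of the Dirac masses at the centered samples, as the image of the uniform
  distribution on the sample indices; \<open>emeasure_centered_empirical\<close> below gives its values.
\<close>

definition centered_empirical :: "('k::finite \<Rightarrow> 'a::euclidean_space) \<Rightarrow> 'a measure" where
  "centered_empirical \<xi> = distr (uniform_count_measure UNIV) borel (centered \<xi>)"

lemma emeasure_centered_empirical:
  fixes \<xi> :: "'k::finite \<Rightarrow> 'a::euclidean_space"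
  assumes "E \<in> sets borel"
  shows "emeasure (centered_empirical \<xi>) E =
    ennreal ((1 / real CARD('k)) * (\<Sum>k\<in>UNIV. indicator E (centered \<xi> k)))"
proof -
  have "emeasure (centered_empirical \<xi>) E = card {k. centered \<xi> k \<in> E} / real CARD('k)"
    unfolding centered_empirical_def using assms
    by (subst emeasure_distr)
      (auto simp: measurable_def uniform_count_measure_def space_point_measure sets_point_measure
        emeasure_uniform_count_measure[unfolded uniform_count_measure_def] vimage_def)
  also have "(\<Sum>k\<in>UNIV. indicator E (centered \<xi> k)) = real (card {k. centered \<xi> k \<in> E})"
    by (simp add: indicator_def sum.If_cases)
  then have "card {k. centered \<xi> k \<in> E} / real CARD('k) =
      (1 / real CARD('k)) * (\<Sum>k\<in>UNIV. indicator E (centered \<xi> k))" by simp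
  finally show ?thesis .
qed

text \<open>
  With \<open>Q\<close> and \<open>R\<close> positive semidefinite the integrand is nonnegative, so \<open>\<integral>\<^sup>+\<close> is its expectation,
  with value in \<open>[0, \<infinity>]\<close>.
\<close>

definition control_cost ::
  "('t::{finite,linorder} \<Rightarrow> real^'n::finite^'n) \<Rightarrow> ('t \<Rightarrow> real^'m::finite^'n) \<Rightarrow>
   ('t \<Rightarrow> real^'n^'p::finite) \<Rightarrow>
   real^('t \<times> 'n)^('t \<times> 'n) \<Rightarrow> real^('t \<times> 'm)^('t \<times> 'm) \<Rightarrow>
   real^('t \<times> 'p)^('t \<times> 'm) \<Rightarrow> (real^(('t \<times> 'n) + ('t \<times> 'p))) measure \<Rightarrow> ennreal" where
  "control_cost A B C Q R K P =
     (\<integral>\<^sup>+\<xi>. (case trajectory A B C K \<xi> of (x, u) \<Rightarrow> ennreal (x \<bullet> (Q *v x) + u \<bullet> (R *v u))) \<partial>P)"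

definition worst_case_cost ::
  "('t::{finite,linorder} \<Rightarrow> real^'n::finite^'n) \<Rightarrow> ('t \<Rightarrow> real^'m::finite^'n) \<Rightarrow>
   ('t \<Rightarrow> real^'n^'p::finite) \<Rightarrow>
   real^('t \<times> 'n)^('t \<times> 'n) \<Rightarrow> real^('t \<times> 'm)^('t \<times> 'm) \<Rightarrow>
   real \<Rightarrow> ('k::finite \<Rightarrow> real^(('t \<times> 'n) + ('t \<times> 'p))) \<Rightarrow>
   real^('t \<times> 'p)^('t \<times> 'm) \<Rightarrow> ennreal" where
  "worst_case_cost A B C Q R \<rho> \<xi> K =
     (SUP P\<in>wasserstein_ball \<rho> (centered_empirical \<xi>). control_cost A B C Q R K P)"

section \<open>Semidefinite program\<close>

text \<open>Decision variables \<open>(\<lambda>, s, \<nu>, P, \<Phi>xx, \<Phi>xy, \<Phi>ux, \<Phi>uy)\<close>.\<close>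

type_synonym ('t, 'n, 'm, 'p, 'k) sdp_vars =
  "real \<times> (real^'k) \<times> (real^(('t \<times> 'n) + ('t \<times> 'p))) \<times>
   (real^(('t \<times> 'n) + ('t \<times> 'p))^(('t \<times> 'n) + ('t \<times> 'p))) \<times>
   (real^('t \<times> 'n)^('t \<times> 'n)) \<times> (real^('t \<times> 'p)^('t \<times> 'n)) \<times>
   (real^('t \<times> 'n)^('t \<times> 'm)) \<times> (real^('t \<times> 'p)^('t \<times> 'm))"

definition sdp_objective ::
  "real \<Rightarrow> ('t::finite, 'n::finite, 'm::finite, 'p::finite, 'k::finite) sdp_vars \<Rightarrow> real" where
  "sdp_objective \<rho> = (\<lambda>(l, s, \<nu>, P, \<Phi>xx, \<Phi>xy, \<Phi>ux, \<Phi>uy).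
     l * \<rho>\<^sup>2 + (1 / real CARD('k)) * (\<Sum>k\<in>UNIV. s $ k))"

definition sdp_feasible ::
  "('t::{finite,linorder} \<Rightarrow> real^'n::finite^'n) \<Rightarrow> ('t \<Rightarrow> real^'m::finite^'n) \<Rightarrow>
   ('t \<Rightarrow> real^'n^'p::finite) \<Rightarrow>
   real^('t \<times> 'n)^('t \<times> 'n) \<Rightarrow> real^('t \<times> 'm)^('t \<times> 'm) \<Rightarrow>
   ('k::finite \<Rightarrow> real^(('t \<times> 'n) + ('t \<times> 'p))) \<Rightarrow>
   ('t, 'n, 'm, 'p, 'k) sdp_vars set" where
  "sdp_feasible A B C Q R \<xi> = {(l, s, \<nu>, P, \<Phi>xx, \<Phi>xy, \<Phi>ux, \<Phi>uy).
     0 \<le> l \<and> transpose P = P \<and> achievable A B C \<Phi>xx \<Phi>xy \<Phi>ux \<Phi>uy \<and>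
     (\<forall>k. let b = columnvector (- (1/2) *\<^sub>R \<nu> + l *\<^sub>R centered \<xi> k) :: real^unit^_ in
        psd (block_mat (l *\<^sub>R mat 1 - P) b
               (transpose b) (mat (s $ k + l * (norm (centered \<xi> k))\<^sup>2)))) \<and>
     (let F = psd_sqrt (block_mat Q 0 0 R) ** block_mat \<Phi>xx \<Phi>xy \<Phi>ux \<Phi>uy in
        psd (block_mat (mat 1) F (transpose F) P))}"

end

theory Submission
  imports Defs
begin

text \<open>
  Achievable responses and causal controllers are in bijection, and the cost of the controller is
  \<open>E |F \<xi>|\<^sup>2\<close> with \<open>F = S\<^sup>1\<^sup>/\<^sup>2 \<Phi>\<close>. By the Schur complements the SDP says \<open>F\<^sup>T F \<le> P \<le> \<lambda> I\<close> and
  \<open>x\<^sup>T P x \<le> s\<^sub>k + \<nu>\<^sup>T x + \<lambda> |x - c\<^sub>k|\<^sup>2\<close> for all \<open>x\<close>, where the \<open>c\<^sub>k\<close> are the centered samples; integrating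
  this against a coupling bounds the worst-case cost by the objective.

  Conversely, let \<open>M = F\<^sup>T F\<close> have largest eigenvalue \<open>\<mu>\<close> with unit eigenvector \<open>e\<close>. For \<open>\<lambda> > \<mu>\<close> put
  \<open>y\<^sub>k = \<lambda> (\<lambda> I - M)\<^sup>-\<^sup>1 c\<^sub>k\<close>, whose mean is zero, and let \<open>h(\<lambda>)\<close> be the mean of \<open>|y\<^sub>k - c\<^sub>k|\<^sup>2\<close>. If \<open>h(\<lambda>) \<le> \<rho>\<^sup>2\<close>,
  spend the rest of the transport budget on the atoms \<open>y\<^sub>k \<plusminus> r e\<close> with \<open>r\<^sup>2 = \<rho>\<^sup>2 - h(\<lambda>)\<close>. This law is in the
  ball, and its cost is less than the objective of a feasible point with \<open>\<nu> = 0\<close> by exactly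
  \<open>(\<lambda> - \<mu>) (\<rho>\<^sup>2 - h(\<lambda>))\<close>, which becomes arbitrarily small: either \<open>h(\<lambda>) = \<rho>\<^sup>2\<close> for some \<open>\<lambda>\<close>, or one lets
  \<open>\<lambda>\<close> tend to \<open>\<mu>\<close>. A minimizer exists since the sublevel sets of the SDP are compact; this uses
  \<open>\<rho> > 0\<close> to bound \<open>\<lambda>\<close> and \<open>R > 0\<close> to bound the responses.
\<close>

section \<open>Eigenbases and square roots of symmetric matrices\<close>

lemma symmetric_inner:
  fixes M :: "real^'n^'n"
  assumes "transpose M = M"
  shows "(M *v x) \<bullet> y = x \<bullet> (M *v y)"
  by (metis assms dot_lmul_matrix transpose_matrix_vector)

lemma symmetricI:
  fixes M :: "real^'n^'n"
  assumes "\<And>x y. (M *v x) \<bullet> y = x \<bullet> (M *v y)"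
  shows "transpose M = M"
proof -
  have "transpose M *v x = M *v x" for x
  proof -
    have "(transpose M *v x) \<bullet> y = (M *v x) \<bullet> y" for y
      by (simp add: assms transpose_matrix_vector dot_lmul_matrix)
    then show ?thesis
      by (metis vector_eq_rdot)
  qed
  then show ?thesis
    by (simp add: matrix_eq)
qed

text \<open>First-order optimality in one variable: the quadratic vanishes at \<open>t = 0\<close>,
  which is therefore a minimum, so the derivative \<open>2 * b\<close> there is zero.\<close>

lemma linear_coeff_zero:
  fixes b c :: real
  assumes "\<And>t. 0 \<le> 2 * t * b + t\<^sup>2 * c"
  shows "b = 0"
proof (rule ccontr)
  assume b: "b \<noteq> 0"
  \<comment> \<open>Any positive \<open>D > c\<close> works: at \<open>t = - b / D\<close> the
    negative linear term outweighs the quadratic one.\<close>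
  define D where "D = \<bar>c\<bar> + 1"
  have D: "D > 0" "c < D" by (auto simp: D_def)
  have "2 * (- b / D) * b + (- b / D)\<^sup>2 * c = (b\<^sup>2 / D) * (c / D - 2)"
    using D by (simp add: field_simps power2_eq_square)
  also have "\<dots> < 0"
  proof (rule mult_pos_neg)
    show "0 < b\<^sup>2 / D" using b D by simp
    have "c / D < 1" using D by simp
    then show "c / D - 2 < 0" by simp
  qed
  finally show False using assms[of "- b / D"] by linarith
qed

text \<open>Maximize the Rayleigh quotient over the compact unit sphere of the invariant subspace
  \<open>V\<close>; a maximizer is an eigenvector, and its eigenvalue is the largest one on
  \<open>V\<close>.\<close>

lemma symmetric_eigenvector:
  fixes M :: "real^'n^'n"
  assumes sym: "transpose M = M" and V: "subspace V" "V \<noteq> {0}"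
    and inv: "\<And>x. x \<in> V \<Longrightarrow> M *v x \<in> V"
  obtains e where "e \<in> V" "norm e = 1" "M *v e = (e \<bullet> (M *v e)) *\<^sub>R e"
    "\<And>x. x \<in> V \<Longrightarrow> x \<bullet> (M *v x) \<le> (e \<bullet> (M *v e)) * (norm x)\<^sup>2"
proof -
  let ?S = "V \<inter> sphere 0 1"
  obtain v where v: "v \<in> V" "v \<noteq> 0" using V subspace_0 by blast
  then have "inverse (norm v) *\<^sub>R v \<in> ?S"
    using V by (simp add: subspace_scale)
  then have "?S \<noteq> {}" by blast
  moreover have "compact ?S"
    using V closed_subspace by (intro closed_Int_compact) auto
  moreover have "continuous_on ?S (\<lambda>x. x \<bullet> (M *v x))"
    by (intro continuous_on_inner continuous_on_id matrix_vector_mult_linear_continuous_on)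
  ultimately have "\<exists>e\<in>?S. \<forall>x\<in>?S. x \<bullet> (M *v x) \<le> e \<bullet> (M *v e)"
    by (intro continuous_attains_sup)
  then obtain e where e: "e \<in> ?S" "\<And>x. x \<in> ?S \<Longrightarrow> x \<bullet> (M *v x) \<le> e \<bullet> (M *v e)"
    by blast
  define \<mu> where "\<mu> = e \<bullet> (M *v e)"
  have max: "x \<bullet> (M *v x) \<le> \<mu> * (norm x)\<^sup>2" if "x \<in> V" for x
  proof (cases "x = 0")
    case False
    then have "inverse (norm x) *\<^sub>R x \<in> ?S"
      using V that by (simp add: subspace_scale)
    from e(2)[OF this] show ?thesis
      using False by (simp add: \<mu>_def matrix_vector_mult_scaleR field_simps power2_eq_square)
  qed simp
  \<comment> \<open>Perturbing the maximizer \<open>e\<close> in a direction \<open>d\<close> of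
    \<open>V\<close> shows that the residual is orthogonal to \<open>V\<close>. It also lies in
    \<open>V\<close> by invariance, so it vanishes.\<close>
  have "(\<mu> *\<^sub>R e - M *v e) \<bullet> d = 0" if d: "d \<in> V" for d
  proof (rule linear_coeff_zero)
    fix t
    have "(e + t *\<^sub>R d) \<bullet> (M *v (e + t *\<^sub>R d)) \<le> \<mu> * (norm (e + t *\<^sub>R d))\<^sup>2"
      using e d V by (intro max) (simp add: subspace_add subspace_scale)
    then have "(e + t *\<^sub>R d) \<bullet> (M *v (e + t *\<^sub>R d)) \<le> \<mu> * ((e + t *\<^sub>R d) \<bullet> (e + t *\<^sub>R d))"
      by (simp only: power2_norm_eq_inner)
    then show "0 \<le> 2 * t * ((\<mu> *\<^sub>R e - M *v e) \<bullet> d) + t\<^sup>2 * (\<mu> * (d \<bullet> d) - d \<bullet> (M *v d))"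
      using e symmetric_inner[OF sym, of e d]
      by (simp add: \<mu>_def inner_add_left inner_add_right inner_diff_left
          matrix_vector_mult_scaleR matrix_vector_right_distrib algebra_simps power2_eq_square
          inner_commute[of d "M *v e"] inner_commute[of d e] norm_eq_1)
  qed
  moreover have "\<mu> *\<^sub>R e - M *v e \<in> V"
    using e V inv by (simp add: subspace_diff subspace_scale)
  ultimately have "M *v e = \<mu> *\<^sub>R e"
    by (metis inner_eq_zero_iff right_minus_eq)
  then show thesis
    using that e max unfolding \<mu>_def by auto
qed

text \<open>Split off one eigenvector \<open>e\<close>. By symmetry its orthogonal complement inside
  \<open>V\<close> is again invariant, and it has smaller dimension.\<close>

lemma symmetric_eigenbasis_subspace:
  fixes M :: "real^'n^'n"
  assumes sym: "transpose M = M" and "subspace V" and "\<And>x. x \<in> V \<Longrightarrow> M *v x \<in> V"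
  shows "\<exists>B \<subseteq> V. span B = V \<and> pairwise orthogonal B \<and>
    (\<forall>b\<in>B. norm b = 1 \<and> M *v b = (b \<bullet> (M *v b)) *\<^sub>R b)"
  using assms(2,3)
proof (induction "dim V" arbitrary: V rule: less_induct)
  case less
  show ?case
  proof (cases "V = {0}")
    case True
    then show ?thesis by (intro exI[of _ "{}"]) auto
  next
    case False
    obtain e where e: "e \<in> V" "norm e = 1" "M *v e = (e \<bullet> (M *v e)) *\<^sub>R e"
      using symmetric_eigenvector[OF sym less.prems(1) False less.prems(2)] by metis
    define W where "W = {x \<in> V. e \<bullet> x = 0}"
    have W: "subspace W"
      using less.prems(1) by (auto simp: W_def subspace_def inner_add_right)
    have "W \<subseteq> V" by (auto simp: W_def)
    moreover have "e \<notin> W" using e by (auto simp: W_def)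
    ultimately have "W \<subset> V" using e by blast
    then have "dim W < dim V"
      using W less.prems(1) by (metis dim_psubset span_eq_iff)
    moreover have "M *v x \<in> W" if "x \<in> W" for x
    proof -
      have "e \<bullet> (M *v x) = (e \<bullet> (M *v e)) * (e \<bullet> x)"
        using e(3) symmetric_inner[OF sym, of e x] by (metis inner_scaleR_left)
      then show ?thesis using that less.prems(2) by (simp add: W_def)
    qed
    ultimately obtain B where B: "B \<subseteq> W" "span B = W" "pairwise orthogonal B"
      "\<forall>b\<in>B. norm b = 1 \<and> M *v b = (b \<bullet> (M *v b)) *\<^sub>R b"
      using less.hyps[of W] W by blast
    have "V \<subseteq> span (insert e B)"
    proof
      fix x assume "x \<in> V"
      have "x - (e \<bullet> x) *\<^sub>R e \<in> W"
        using \<open>x \<in> V\<close> e less.prems(1)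
        by (simp add: W_def subspace_diff subspace_scale inner_diff_right norm_eq_1)
      then show "x \<in> span (insert e B)"
        using B(2) by (auto simp: span_insert)
    qed
    moreover have "span (insert e B) \<subseteq> V"
      using B(1) e(1) less.prems(1) by (intro span_minimal) (auto simp: W_def)
    moreover have "pairwise orthogonal (insert e B)"
      using B(1,3) by (intro pairwise_orthogonal_insert) (auto simp: W_def orthogonal_def)
    ultimately show ?thesis
      using B(1,4) e by (intro exI[of _ "insert e B"]) (auto simp: W_def)
  qed
qed

lemma symmetric_eigenbasis:
  fixes M :: "real^'n^'n"
  assumes "transpose M = M"
  obtains B where "finite B" "span B = UNIV" "pairwise orthogonal B"
    "\<And>b. b \<in> B \<Longrightarrow> norm b = 1" "\<And>b. b \<in> B \<Longrightarrow> M *v b = (b \<bullet> (M *v b)) *\<^sub>R b"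
proof -
  obtain B where "span B = UNIV" "pairwise orthogonal B"
    "\<forall>b\<in>B. norm b = 1 \<and> M *v b = (b \<bullet> (M *v b)) *\<^sub>R b"
    using symmetric_eigenbasis_subspace[OF assms subspace_UNIV] by auto
  then show thesis
    using that pairwise_orthogonal_imp_finite by blast
qed

lemma matrix_eq_on_span:
  fixes L M :: "real^'n^'m"
  assumes "span B = UNIV" and "\<And>b. b \<in> B \<Longrightarrow> L *v b = M *v b"
  shows "L = M"
proof -
  have "L *v x = M *v x" for x
    using assms(1) by (intro linear_eq_on_span[of "(*v) L" "(*v) M" B x]) (auto simp: assms(2))
  then show ?thesis by (simp add: matrix_eq)
qed

text \<open>In an orthonormal eigenbasis, replace each eigenvalue by its square root.\<close>

lemma psd_sqrt_exists:
  fixes M :: "real^'n^'n"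
  assumes "psd M"
  shows "\<exists>L. psd L \<and> L ** L = M"
proof -
  from assms have sym: "transpose M = M" and pos: "0 \<le> b \<bullet> (M *v b)" for b
    by (auto simp: psd_def)
  obtain B where B: "finite B" "span B = UNIV" "pairwise orthogonal B"
    "\<And>b. b \<in> B \<Longrightarrow> norm b = 1" "\<And>b. b \<in> B \<Longrightarrow> M *v b = (b \<bullet> (M *v b)) *\<^sub>R b"
    using symmetric_eigenbasis[OF sym] by metis
  define r where "r b = sqrt (b \<bullet> (M *v b))" for b
  define f where "f x = (\<Sum>b\<in>B. (r b * (b \<bullet> x)) *\<^sub>R b)" for x
  have "linear f"
    unfolding f_def
    by (intro linearI) (simp_all add: inner_add_right algebra_simps sum.distrib scaleR_sum_right)
  then have L: "matrix f *v x = f x" for x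
    by simp
  have fb: "f c = r c *\<^sub>R c" if c: "c \<in> B" for c
  proof -
    have "(r b * (b \<bullet> c)) *\<^sub>R b = (if b = c then r c *\<^sub>R c else 0)" if "b \<in> B" for b
      using that c B(3,4) by (auto simp: pairwise_def orthogonal_def norm_eq_1)
    then have "f c = (\<Sum>b\<in>B. if b = c then r c *\<^sub>R c else 0)"
      unfolding f_def by (intro sum.cong) auto
    then show ?thesis using B(1) c by simp
  qed
  have form: "x \<bullet> f y = (\<Sum>b\<in>B. r b * (b \<bullet> x) * (b \<bullet> y))" for x y
    by (simp add: f_def inner_sum_right inner_commute mult_ac)
  have "psd (matrix f)"
    unfolding psd_def
  proof (intro conjI allI symmetricI)
    show "(matrix f *v x) \<bullet> y = x \<bullet> (matrix f *v y)" for x y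
      unfolding L by (subst inner_commute) (simp add: form mult_ac)
    show "0 \<le> x \<bullet> (matrix f *v x)" for x
      unfolding L form by (intro sum_nonneg) (simp add: r_def pos mult.assoc)
  qed
  moreover have "matrix f ** matrix f = M"
  proof (rule matrix_eq_on_span[OF B(2)])
    fix b assume b: "b \<in> B"
    have "(matrix f ** matrix f) *v b = (r b * r b) *\<^sub>R b"
      by (simp add: matrix_vector_mul_assoc[symmetric] L fb b linear_cmul[OF \<open>linear f\<close>])
    also have "\<dots> = M *v b"
      by (simp add: r_def pos B(5)[OF b, symmetric])
    finally show "(matrix f ** matrix f) *v b = M *v b" .
  qed
  ultimately show ?thesis by blast
qed

text \<open>Every positive semidefinite root must scale an eigenvector of \<open>M\<close> by the
  square root of its eigenvalue, so two roots agree on an eigenbasis.\<close>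

lemma psd_sqrt_unique:
  fixes M :: "real^'n^'n"
  assumes "psd L" "L ** L = M" "psd L'" "L' ** L' = M"
  shows "L = L'"
proof -
  have "transpose M = M"
    using assms(1,2) unfolding psd_def by (metis matrix_transpose_mul)
  then obtain B where B: "span B = UNIV"
    "\<And>b. b \<in> B \<Longrightarrow> M *v b = (b \<bullet> (M *v b)) *\<^sub>R b"
    using symmetric_eigenbasis by metis
  have root: "N *v b = sqrt (b \<bullet> (M *v b)) *\<^sub>R b" if N: "psd N" "N ** N = M" and b: "b \<in> B" for N b
  proof -
    from N have sym: "transpose N = N" and pos: "0 \<le> x \<bullet> (N *v x)" for x
      by (auto simp: psd_def)
    have NN: "N *v (N *v x) = M *v x" for x
      by (simp add: matrix_vector_mul_assoc N)
    define r where "r = sqrt (b \<bullet> (M *v b))"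
    have bMb: "b \<bullet> (M *v b) = (N *v b) \<bullet> (N *v b)"
      using symmetric_inner[OF sym, of b "N *v b"] by (simp add: NN)
    then have r: "0 \<le> r" "r * r = b \<bullet> (M *v b)" by (auto simp: r_def)
    define d where "d = N *v b - r *\<^sub>R b"
    show ?thesis
    proof (cases "r = 0")
      case True
      then show ?thesis using r bMb by simp
    next
      case False
      \<comment> \<open>This is the factorization
        \<open>(N + r I) (N - r I) b = M b - r\<^sup>2 b = 0\<close>. For \<open>r > 0\<close> the
        factor \<open>N + r I\<close> is positive definite, which forces
        \<open>d = 0\<close>.\<close>
      have "N *v d + r *\<^sub>R d = M *v b - (r * r) *\<^sub>R b"
        by (simp add: d_def matrix_vector_mult_diff_distrib matrix_vector_mult_scaleR NN algebra_simps)
      also have "\<dots> = 0" by (simp add: r B(2)[OF b, symmetric])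
      finally have "d \<bullet> (N *v d + r *\<^sub>R d) = 0" by simp
      then have "d \<bullet> (N *v d) + r * (d \<bullet> d) = 0" by (simp add: inner_add_right)
      moreover have "0 \<le> r * (d \<bullet> d)" using r by simp
      ultimately have "r * (d \<bullet> d) = 0" using pos[of d] by linarith
      then have "d = 0" using False by simp
      then show ?thesis by (simp add: d_def r_def)
    qed
  qed
  show ?thesis
    using assms by (intro matrix_eq_on_span[OF B(1)]) (simp add: root)
qed

text \<open>Existence and uniqueness make the definite description in \<open>psd_sqrt\<close>
  denote.\<close>

lemma psd_psd_sqrt:
  assumes "psd M"
  shows "psd (psd_sqrt M)" "psd_sqrt M ** psd_sqrt M = M"
proof -
  have "\<exists>!L. psd L \<and> L ** L = M"
    using psd_sqrt_exists[OF assms] psd_sqrt_unique by blast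
  then have "psd (psd_sqrt M) \<and> psd_sqrt M ** psd_sqrt M = M"
    unfolding psd_sqrt_def by (rule theI')
  then show "psd (psd_sqrt M)" "psd_sqrt M ** psd_sqrt M = M" by auto
qed

lemma psd_sqrt_inner:
  assumes "psd M"
  shows "(psd_sqrt M *v x) \<bullet> (psd_sqrt M *v x) = x \<bullet> (M *v x)"
  using psd_psd_sqrt[OF assms] symmetric_inner[of "psd_sqrt M" x "psd_sqrt M *v x"]
  by (simp add: psd_def matrix_vector_mul_assoc)

section \<open>Block matrices\<close>

definition vjoin :: "real^'a \<Rightarrow> real^'b \<Rightarrow> real^('a::finite + 'b::finite)" where
  "vjoin x y = (\<chi> i. case i of Inl a \<Rightarrow> x $ a | Inr b \<Rightarrow> y $ b)"

lemma vjoin_nth [simp]: "vjoin x y $ Inl a = x $ a" "vjoin x y $ Inr b = y $ b"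
  by (simp_all add: vjoin_def)

lemma block_row_nth [simp]:
  "block_row M N $ i $ Inl b = M $ i $ b" "block_row M N $ i $ Inr c = N $ i $ c"
  by (simp_all add: block_row_def)

lemma block_col_nth [simp]: "block_col M N $ Inl a = M $ a" "block_col M N $ Inr b = N $ b"
  by (simp_all add: block_col_def)

lemma sum_UNIV_Plus:
  fixes f :: "'a::finite + 'b::finite \<Rightarrow> 'c::comm_monoid_add"
  shows "(\<Sum>i\<in>UNIV. f i) = (\<Sum>a\<in>UNIV. f (Inl a)) + (\<Sum>b\<in>UNIV. f (Inr b))"
  by (subst UNIV_Plus_UNIV[symmetric], subst sum.Plus) (simp_all only: finite comp_def)

lemma vec_sum_eq_iff:
  fixes x y :: "'c^('a::finite + 'b::finite)"
  shows "x = y \<longleftrightarrow> (\<forall>a. x $ Inl a = y $ Inl a) \<and> (\<forall>b. x $ Inr b = y $ Inr b)"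
  by (auto simp: vec_eq_iff split_sum_all)

lemma vjoin_cases:
  fixes z :: "real^('a::finite + 'b::finite)"
  obtains x y where "z = vjoin x y"
proof
  show "z = vjoin (\<chi> a. z $ Inl a) (\<chi> b. z $ Inr b)"
    by (simp add: vec_sum_eq_iff)
qed

lemma all_vjoin:
  fixes Q :: "real^('a::finite + 'b::finite) \<Rightarrow> bool"
  shows "(\<forall>z. Q z) \<longleftrightarrow> (\<forall>x y. Q (vjoin x y))"
  by (metis vjoin_cases)

lemma inner_vjoin: "vjoin x y \<bullet> vjoin x' y' = x \<bullet> x' + y \<bullet> y'"
  by (simp add: inner_vec_def sum_UNIV_Plus)

lemma block_row_vjoin: "block_row M N *v vjoin x y = M *v x + N *v y"
  by (simp add: vec_eq_iff matrix_vector_mult_def sum_UNIV_Plus)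

lemma block_col_vec: "block_col M N *v x = vjoin (M *v x) (N *v x)"
  by (simp add: vec_sum_eq_iff matrix_vector_mult_def)

lemma block_mat_vjoin:
  "block_mat M11 M12 M21 M22 *v vjoin x y =
    vjoin (M11 *v x + M12 *v y) (M21 *v x + M22 *v y)"
  by (simp add: block_mat_def block_col_vec block_row_vjoin)

lemma block_row_mult_block_mat:
  "block_row X Y ** block_mat M11 M12 M21 M22 =
    block_row (X ** M11 + Y ** M21) (X ** M12 + Y ** M22)"
  by (simp add: vec_eq_iff split_sum_all matrix_matrix_mult_def sum_UNIV_Plus block_mat_def)

lemma block_mat_mult_block_col:
  "block_mat M11 M12 M21 M22 ** block_col X Y =
    block_col (M11 ** X + M12 ** Y) (M21 ** X + M22 ** Y)"
  by (simp add: vec_eq_iff split_sum_all matrix_matrix_mult_def sum_UNIV_Plus block_mat_def)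

lemma block_row_eq_iff: "block_row M N = block_row M' N' \<longleftrightarrow> M = M' \<and> N = N'"
  by (auto simp: vec_eq_iff split_sum_all)

lemma block_col_eq_iff: "block_col M N = block_col M' N' \<longleftrightarrow> M = M' \<and> N = N'"
  by (auto simp: vec_eq_iff split_sum_all)

lemma transpose_block_mat:
  "transpose (block_mat M11 M12 M21 M22) =
    block_mat (transpose M11) (transpose M21) (transpose M12) (transpose M22)"
  by (simp add: vec_eq_iff split_sum_all transpose_def block_mat_def)

lemma block_mat_eq_iff:
  "block_mat M11 M12 M21 M22 = block_mat N11 N12 N21 N22 \<longleftrightarrow>
    M11 = N11 \<and> M12 = N12 \<and> M21 = N21 \<and> M22 = N22"
  by (auto simp: block_mat_def block_row_eq_iff block_col_eq_iff)

lemma inner_transpose: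
  fixes M :: "real^'n^'m"
  shows "x \<bullet> (transpose M *v y) = y \<bullet> (M *v x)"
  by (metis dot_lmul_matrix inner_commute transpose_matrix_vector)

text \<open>The two off-diagonal blocks are transposes of each other, so they contribute equally to
  the quadratic form at \<open>vjoin x y\<close>; hence the factor 2.\<close>

lemma psd_block_mat:
  "psd (block_mat X Y (transpose Y) Z) \<longleftrightarrow> transpose X = X \<and> transpose Z = Z \<and>
    (\<forall>x y. 0 \<le> x \<bullet> (X *v x) + 2 * (x \<bullet> (Y *v y)) + y \<bullet> (Z *v y))"
  unfolding psd_def all_vjoin
  by (auto simp: transpose_block_mat block_mat_eq_iff block_mat_vjoin inner_vjoin
      inner_add_right inner_transpose algebra_simps simp del: transpose_matrix_vector)

lemma columnvector_vec: "(columnvector b :: real^unit^'n) *v y = (y $ ()) *\<^sub>R b"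
  by (simp add: vec_eq_iff matrix_vector_mult_def columnvector_def UNIV_unit)

lemma mat_vec_unit: "(mat c :: real^unit^unit) *v y = c *\<^sub>R y"
  by (simp add: vec_eq_iff matrix_vector_mult_def mat_def UNIV_unit)

text \<open>The lower right block is one by one, so the second component of a test vector is a
  single scalar \<open>t\<close>. Keeping \<open>t\<close> leaves the condition linear in
  \<open>l\<close>, \<open>P\<close>, \<open>b\<close> and \<open>c\<close>.\<close>

lemma lmi_iff:
  fixes P :: "real^'d^'d"
  assumes "transpose P = P"
  shows "psd (block_mat (l *\<^sub>R mat 1 - P) (columnvector b :: real^unit^'d)
      (transpose (columnvector b)) (mat c)) \<longleftrightarrow>
    (\<forall>x t. 0 \<le> l * (x \<bullet> x) - x \<bullet> (P *v x) + 2 * t * (x \<bullet> b) + t\<^sup>2 * c)"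
proof -
  have "transpose (l *\<^sub>R mat 1 - P) = l *\<^sub>R mat 1 - P"
    using assms by (simp add: vec_eq_iff transpose_def mat_def)
  moreover have "x \<bullet> ((l *\<^sub>R mat 1 - P) *v x) + 2 * (x \<bullet> ((y $ ()) *\<^sub>R b)) + y \<bullet> (c *\<^sub>R y) =
      l * (x \<bullet> x) - x \<bullet> (P *v x) + 2 * (y $ ()) * (x \<bullet> b) + (y $ ())\<^sup>2 * c"
    for x and y :: "real^unit"
    by (simp add: matrix_vector_mult_diff_rdistrib scaleR_matrix_vector_assoc[symmetric]
        inner_diff_right inner_vec_def[where 'b=unit] UNIV_unit power2_eq_square)
  moreover have "(\<forall>y::real^unit. Q (y $ ())) \<longleftrightarrow> (\<forall>t. Q t)" for Q
    by (metis vec_component)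
  from this[of "\<lambda>t. 0 \<le> l * (x \<bullet> x) - x \<bullet> (P *v x) + 2 * t * (x \<bullet> b) + t\<^sup>2 * c" for x]
  have "(\<forall>y::real^unit. 0 \<le> l * (x \<bullet> x) - x \<bullet> (P *v x) + 2 * (y $ ()) * (x \<bullet> b) + (y $ ())\<^sup>2 * c)
      \<longleftrightarrow> (\<forall>t. 0 \<le> l * (x \<bullet> x) - x \<bullet> (P *v x) + 2 * t * (x \<bullet> b) + t\<^sup>2 * c)" for x .
  ultimately show ?thesis
    unfolding psd_block_mat columnvector_vec mat_vec_unit by (simp only: transpose_mat simp_thms)
qed

text \<open>Completing the square: the left side is smallest at
  \<open>x = - (F *v y)\<close>.\<close>

lemma schur_form:
  fixes F :: "real^'d^'n"
  shows "(\<forall>x. 0 \<le> x \<bullet> x + 2 * (x \<bullet> (F *v y)) + c) \<longleftrightarrow> (F *v y) \<bullet> (F *v y) \<le> c"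
proof
  assume "\<forall>x. 0 \<le> x \<bullet> x + 2 * (x \<bullet> (F *v y)) + c"
  from spec[OF this, of "- (F *v y)"] show "(F *v y) \<bullet> (F *v y) \<le> c" by simp
next
  assume le: "(F *v y) \<bullet> (F *v y) \<le> c"
  have "0 \<le> x \<bullet> x + 2 * (x \<bullet> (F *v y)) + (F *v y) \<bullet> (F *v y)" for x
    using inner_ge_zero[of "x + F *v y"]
    by (simp add: inner_add_left inner_add_right inner_commute[of "F *v y" x])
  then show "\<forall>x. 0 \<le> x \<bullet> x + 2 * (x \<bullet> (F *v y)) + c"
    using le by (meson add_left_mono order_trans)
qed

lemma schur_iff:
  "psd (block_mat (mat 1) F (transpose F) P) \<longleftrightarrow>
    transpose P = P \<and> (\<forall>y. (F *v y) \<bullet> (F *v y) \<le> y \<bullet> (P *v y))"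
proof -
  have "psd (block_mat (mat 1) F (transpose F) P) \<longleftrightarrow>
      transpose P = P \<and> (\<forall>y x. 0 \<le> x \<bullet> x + 2 * (x \<bullet> (F *v y)) + y \<bullet> (P *v y))"
    by (auto simp: psd_block_mat transpose_mat)
  then show ?thesis by (simp only: schur_form)
qed

lemma matrix_diff_ldistrib: "A ** (B - C) = A ** B - A ** C" for A :: "real^'n^'m"
  by (simp add: vec_eq_iff matrix_matrix_mult_def algebra_simps sum_subtractf)

lemma matrix_add_rdistrib: "(A + B) ** C = A ** C + B ** C" for A :: "real^'n^'m"
  by (simp add: vec_eq_iff matrix_matrix_mult_def algebra_simps sum.distrib)

lemma matrix_diff_rdistrib: "(A - B) ** C = A ** C - B ** C" for A :: "real^'n^'m"
  by (simp add: vec_eq_iff matrix_matrix_mult_def algebra_simps sum_subtractf)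

lemma matrix_minus_left: "(- A) ** B = - (A ** B)" for A :: "real^'n^'m"
  by (simp add: vec_eq_iff matrix_matrix_mult_def sum_negf)

lemma matrix_minus_right: "A ** (- B) = - (A ** B)" for A :: "real^'n^'m"
  by (simp add: vec_eq_iff matrix_matrix_mult_def sum_negf)

section \<open>Causal matrices and achievable responses\<close>

text \<open>Such matrices are nilpotent, so \<open>mat 1 - N\<close> is invertible for them. The
  one-step delay in \<open>downshift\<close> is what produces them here.\<close>

definition strictly_causal ::
  "real^('t::{finite,linorder} \<times> 'b::finite)^('t \<times> 'a::finite) \<Rightarrow> bool" where
  "strictly_causal M \<longleftrightarrow> (\<forall>t s i j. t \<le> s \<longrightarrow> M $ (t, i) $ (s, j) = 0)"

lemma strictly_causal_imp_causal: "strictly_causal M \<Longrightarrow> causal M"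
  by (simp add: strictly_causal_def causal_def)

lemma causal_add: "causal M \<Longrightarrow> causal N \<Longrightarrow> causal (M + N)"
  and causal_diff: "causal M \<Longrightarrow> causal N \<Longrightarrow> causal (M - N)"
  and causal_mat: "causal (mat c)"
  and causal_zero: "causal 0"
  and causal_blkdiag: "causal (blkdiag X)"
  by (auto simp: causal_def mat_def blkdiag_def)

lemma strictly_causal_add: "strictly_causal M \<Longrightarrow> strictly_causal N \<Longrightarrow> strictly_causal (M + N)"
  by (simp add: strictly_causal_def)

lemma strictly_causal_downshift: "strictly_causal downshift"
  by (auto simp: strictly_causal_def downshift_def next_time_def)

lemma causal_mult:
  assumes "causal M" "causal N"
  shows "causal (M ** N)"
  unfolding causal_def
proof (intro allI impI)
  fix t s :: 'a and i j assume "t < s"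
  then have "M $ (t, i) $ k * N $ k $ (s, j) = 0" for k
    using assms by (cases k; cases "t < fst k") (auto simp: causal_def)
  then show "(M ** N) $ (t, i) $ (s, j) = 0"
    unfolding matrix_matrix_mult_def by (simp only: vec_lambda_beta sum.neutral_const)
qed

lemma strictly_causal_mult:
  assumes "strictly_causal M" "causal N"
  shows "strictly_causal (M ** N)"
  unfolding strictly_causal_def
proof (intro allI impI)
  fix t s :: 'a and i j assume "t \<le> s"
  then have "M $ (t, i) $ k * N $ k $ (s, j) = 0" for k
    using assms by (cases k; cases "t \<le> fst k") (auto simp: causal_def strictly_causal_def)
  then show "(M ** N) $ (t, i) $ (s, j) = 0"
    unfolding matrix_matrix_mult_def by (simp only: vec_lambda_beta sum.neutral_const)
qed

text \<open>A finite linear order is well founded: the number of earlier time points strictly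
  decreases.\<close>

lemma time_induct [case_names step]:
  fixes t :: "'t::{finite,linorder}"
  assumes "\<And>t. (\<And>s. s < t \<Longrightarrow> Q s) \<Longrightarrow> Q t"
  shows "Q t"
proof (induction "card {..<t}" arbitrary: t rule: less_induct)
  case less
  have "card {..<s} < card {..<t}" if "s < t" for s
    using that by (intro psubset_card_mono) auto
  then show ?case using less assms by blast
qed

text \<open>The block row of \<open>N ** X\<close> at time \<open>t\<close> involves only block rows
  of \<open>X\<close> at earlier times, so causality propagates forward in time.\<close>

lemma strictly_causal_fixpoint:
  assumes "strictly_causal N" "causal Y" and X: "X = Y + N ** X"
  shows "causal X"
proof -
  have "\<forall>s i j. t < s \<longrightarrow> X $ (t, i) $ (s, j) = 0" for t
  proof (induction t rule: time_induct)
    case (step t)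
    show ?case
    proof (intro allI impI)
      fix s i j assume "t < s"
      then have "N $ (t, i) $ k * X $ k $ (s, j) = 0" for k
        using assms(1) step by (cases k; cases "t \<le> fst k") (auto simp: strictly_causal_def)
      then have "(N ** X) $ (t, i) $ (s, j) = 0"
        unfolding matrix_matrix_mult_def by (simp only: vec_lambda_beta sum.neutral_const)
      then show "X $ (t, i) $ (s, j) = 0"
        using assms(2) \<open>t < s\<close> by (subst X) (simp add: causal_def)
    qed
  qed
  then show ?thesis by (simp add: causal_def)
qed

text \<open>A kernel vector satisfies \<open>x = N *v x\<close>, so each of its blocks is determined
  by earlier blocks; forward in time they all vanish.\<close>

lemma strictly_causal_invertible:
  assumes N: "strictly_causal N"
  shows "invertible (mat 1 - N)"
proof -
  have "x = 0" if "(mat 1 - N) *v x = 0" for x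
  proof -
    from that have x: "x = N *v x"
      by (simp add: matrix_vector_mult_diff_rdistrib)
    have "\<forall>i. x $ (t, i) = 0" for t
    proof (induction t rule: time_induct)
      case (step t)
      have "N $ (t, i) $ k * x $ k = 0" for i k
        using N step by (cases k; cases "t \<le> fst k") (auto simp: strictly_causal_def)
      then have "(N *v x) $ (t, i) = 0" for i
        unfolding matrix_vector_mult_def by (simp only: vec_lambda_beta sum.neutral_const)
      then show ?case using x by simp
    qed
    then show ?thesis by (simp add: vec_eq_iff split_paired_all)
  qed
  then have "inj ((*v) (mat 1 - N))"
    by (subst linear_injective_0) auto
  then show ?thesis
    by (metis invertible_left_inverse matrix_left_invertible_injective)
qed

text \<open>The inverse solves \<open>X = mat 1 + N ** X\<close>, and the fixpoint lemma makes it
  causal.\<close>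

lemma strictly_causal_inverse:
  assumes N: "strictly_causal N"
  obtains X where "causal X" "(mat 1 - N) ** X = mat 1" "X ** (mat 1 - N) = mat 1"
proof -
  obtain X where X: "(mat 1 - N) ** X = mat 1" "X ** (mat 1 - N) = mat 1"
    using strictly_causal_invertible[OF N] by (auto simp: invertible_def)
  then have "X = mat 1 + N ** X"
    by (simp add: matrix_diff_rdistrib algebra_simps)
  from strictly_causal_fixpoint[OF N causal_mat this] that X show thesis by blast
qed

section \<open>Correspondence between achievable responses and causal controllers\<close>

lemma achievable_iff:
  "achievable A B C \<Phi>xx \<Phi>xy \<Phi>ux \<Phi>uy \<longleftrightarrow>
    causal \<Phi>xx \<and> causal \<Phi>xy \<and> causal \<Phi>ux \<and> causal \<Phi>uy \<and>
    (mat 1 - downshift ** blkdiag A) ** \<Phi>xx - downshift ** blkdiag B ** \<Phi>ux = mat 1 \<and>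
    (mat 1 - downshift ** blkdiag A) ** \<Phi>xy - downshift ** blkdiag B ** \<Phi>uy = 0 \<and>
    \<Phi>xx ** (mat 1 - downshift ** blkdiag A) - \<Phi>xy ** blkdiag C = mat 1 \<and>
    \<Phi>ux ** (mat 1 - downshift ** blkdiag A) - \<Phi>uy ** blkdiag C = 0"
  by (simp only: achievable_def block_row_mult_block_mat block_mat_mult_block_col
      block_row_eq_iff block_col_eq_iff matrix_minus_left matrix_minus_right
      add_uminus_conv_diff conj_assoc)

text \<open>The first achievability equation writes \<open>\<Phi>xx\<close> as the identity plus a
  strictly causal matrix, because every other term passes through \<open>downshift\<close>.\<close>

lemma achievable_response_invertible:
  assumes "achievable A B C \<Phi>xx \<Phi>xy \<Phi>ux \<Phi>uy"
  obtains Y where "causal Y" "Y ** \<Phi>xx = mat 1" "\<Phi>xx ** Y = mat 1"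
proof -
  define N where "N = downshift ** blkdiag A ** \<Phi>xx + downshift ** blkdiag B ** \<Phi>ux"
  have "strictly_causal (- N)"
  proof -
    have "strictly_causal N"
      unfolding N_def using assms
      by (intro strictly_causal_add strictly_causal_mult strictly_causal_downshift causal_blkdiag)
        (auto simp: achievable_iff)
    then show ?thesis by (simp add: strictly_causal_def)
  qed
  then obtain Y where Y: "causal Y" "(mat 1 - (- N)) ** Y = mat 1" "Y ** (mat 1 - (- N)) = mat 1"
    by (rule strictly_causal_inverse)
  have "\<Phi>xx = mat 1 - (- N)"
    using assms by (simp add: achievable_iff N_def matrix_diff_rdistrib algebra_simps)
  then show thesis using that Y by simp
qed

lemma matrix_inv_unique:
  fixes M :: "real^'n^'n"
  assumes "Y ** M = mat 1" "M ** Y = mat 1"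
  shows "invertible M" "matrix_inv M = Y"
proof -
  show "invertible M" using assms by (auto simp: invertible_def)
  have "matrix_inv M ** M = mat 1"
    using assms unfolding matrix_inv_def by (metis (mono_tags, lifting) someI_ex)
  have "matrix_inv M = matrix_inv M ** (M ** Y)" by (simp add: assms)
  also have "\<dots> = Y" using \<open>matrix_inv M ** M = mat 1\<close> by (simp add: matrix_mul_assoc)
  finally show "matrix_inv M = Y" .
qed

lemma trajectory_eqI:
  assumes "causal K" "closed_loop A B C K \<xi> x u"
  shows "trajectory A B C K \<xi> = (x, u)"
proof -
  have "(THE z. case z of (x, u) \<Rightarrow> closed_loop A B C K \<xi> x u) = (x, u)"
    by (rule the1_equality[OF closed_loop_unique[OF assms(1)]]) (simp add: assms(2))
  then show ?thesis by (simp add: trajectory_def)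
qed

lemma vjoin_noise: "\<xi> = vjoin (state_noise \<xi>) (output_noise \<xi>)"
  by (simp add: vec_sum_eq_iff state_noise_def output_noise_def)

text \<open>Achievability makes the responses obey the dynamics, and the two identities for
  \<open>K\<close> say that the input response equals \<open>K\<close> applied to the output
  response. Uniqueness of the closed loop then identifies the trajectory.\<close>

lemma trajectory_response:
  fixes \<xi> :: "real^(('t::{finite,linorder} \<times> 'n::finite) + ('t \<times> 'p::finite))"
  assumes "causal K" and ach: "achievable A B C \<Phi>xx \<Phi>xy \<Phi>ux \<Phi>uy"
    and x: "K ** blkdiag C ** \<Phi>xx = \<Phi>ux" and y: "K ** blkdiag C ** \<Phi>xy + K = \<Phi>uy"
  obtains x u where "trajectory A B C K \<xi> = (x, u)"
    "block_mat \<Phi>xx \<Phi>xy \<Phi>ux \<Phi>uy *v \<xi> = vjoin x u"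
proof -
  define w v where "w = state_noise \<xi>" and "v = output_noise \<xi>"
  define x where "x = \<Phi>xx *v w + \<Phi>xy *v v"
  define u where "u = \<Phi>ux *v w + \<Phi>uy *v v"
  have "((mat 1 - downshift ** blkdiag A) ** \<Phi>xx - downshift ** blkdiag B ** \<Phi>ux) *v w = w"
    "((mat 1 - downshift ** blkdiag A) ** \<Phi>xy - downshift ** blkdiag B ** \<Phi>uy) *v v = 0"
    using ach by (simp_all add: achievable_iff)
  then have "x = (downshift ** blkdiag A) *v x + (downshift ** blkdiag B) *v u + w"
    by (simp add: x_def u_def matrix_diff_rdistrib matrix_vector_mul_assoc[symmetric] algebra_simps)
  moreover have "u = K *v (blkdiag C *v x + v)"
    unfolding u_def x_def x[symmetric] y[symmetric]
    by (simp add: matrix_vector_mul_assoc[symmetric] algebra_simps)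
  ultimately have "closed_loop A B C K \<xi> x u"
    by (simp add: closed_loop_def w_def v_def)
  then have "trajectory A B C K \<xi> = (x, u)"
    by (rule trajectory_eqI[OF \<open>causal K\<close>])
  moreover have "block_mat \<Phi>xx \<Phi>xy \<Phi>ux \<Phi>uy *v \<xi> = vjoin x u"
    by (subst vjoin_noise) (simp add: block_mat_vjoin x_def u_def w_def v_def)
  ultimately show thesis by (rule that)
qed

text \<open>The right-hand achievability equations eliminate \<open>\<Phi>uy ** blkdiag C\<close>
  and \<open>\<Phi>xy ** blkdiag C\<close>. What remains is that \<open>K ** blkdiag C\<close>
  equals \<open>\<Phi>ux\<close> times the inverse of \<open>\<Phi>xx\<close>, and both controller
  identities follow from it.\<close>

lemma achievable_controller:
  assumes ach: "achievable A B C \<Phi>xx \<Phi>xy \<Phi>ux \<Phi>uy"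
  defines "K \<equiv> \<Phi>uy - \<Phi>ux ** matrix_inv \<Phi>xx ** \<Phi>xy"
  shows "invertible \<Phi>xx" "causal K"
    "K ** blkdiag C ** \<Phi>xx = \<Phi>ux" "K ** blkdiag C ** \<Phi>xy + K = \<Phi>uy"
proof -
  obtain Y where Y: "causal Y" "Y ** \<Phi>xx = mat 1" "\<Phi>xx ** Y = mat 1"
    using achievable_response_invertible[OF ach] .
  show "invertible \<Phi>xx" using matrix_inv_unique[OF Y(2,3)] by blast
  have K: "K = \<Phi>uy - \<Phi>ux ** Y ** \<Phi>xy"
    using matrix_inv_unique[OF Y(2,3)] by (simp add: K_def)
  show "causal K"
    unfolding K using ach Y by (intro causal_diff causal_mult) (auto simp: achievable_iff)
  let ?D = "mat 1 - downshift ** blkdiag A"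
  have yC: "\<Phi>uy ** blkdiag C = \<Phi>ux ** ?D" and xC: "\<Phi>xy ** blkdiag C = \<Phi>xx ** ?D - mat 1"
    using ach unfolding achievable_iff by (auto simp: algebra_simps)
  have "K ** blkdiag C = \<Phi>ux ** ?D - \<Phi>ux ** Y ** (\<Phi>xx ** ?D - mat 1)"
    by (simp add: K matrix_diff_rdistrib yC matrix_mul_assoc[symmetric] xC)
  also have "\<Phi>ux ** Y ** (\<Phi>xx ** ?D - mat 1) = \<Phi>ux ** (Y ** \<Phi>xx) ** ?D - \<Phi>ux ** Y"
    by (simp only: matrix_diff_ldistrib matrix_mul_assoc matrix_mul_rid)
  finally have KC: "K ** blkdiag C = \<Phi>ux ** Y" by (simp add: Y)
  show "K ** blkdiag C ** \<Phi>xx = \<Phi>ux"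
    by (simp add: KC Y matrix_mul_assoc[symmetric])
  show "K ** blkdiag C ** \<Phi>xy + K = \<Phi>uy"
    unfolding KC by (simp add: K)
qed

text \<open>Closing the loop gives \<open>x = N x + Z B K v + w\<close> with
  \<open>N = Z A + Z B K C\<close>. Hence the causal inverse \<open>X\<close> of
  \<open>mat 1 - N\<close> is the response to \<open>w\<close>, and \<open>X Z B K\<close> is the
  state response to \<open>v\<close>.\<close>

lemma causal_achievable:
  fixes A :: "'t::{finite,linorder} \<Rightarrow> real^'n::finite^'n"
  assumes K: "causal K"
  obtains \<Phi>xx \<Phi>xy \<Phi>ux \<Phi>uy where "achievable A B C \<Phi>xx \<Phi>xy \<Phi>ux \<Phi>uy"
    "K ** blkdiag C ** \<Phi>xx = \<Phi>ux" "K ** blkdiag C ** \<Phi>xy + K = \<Phi>uy"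
proof -
  let ?ZA = "downshift ** blkdiag A" and ?ZB = "downshift ** blkdiag B" and ?C = "blkdiag C"
  define N where "N = ?ZA + ?ZB ** K ** ?C"
  have ZB: "strictly_causal ?ZB"
    by (intro strictly_causal_mult strictly_causal_downshift causal_blkdiag)
  have "strictly_causal N"
    unfolding N_def
    by (intro strictly_causal_add strictly_causal_mult strictly_causal_downshift causal_blkdiag K)
  then obtain X where X: "causal X" "(mat 1 - N) ** X = mat 1" "X ** (mat 1 - N) = mat 1"
    by (rule strictly_causal_inverse)
  have left: "(mat 1 - ?ZA) ** X - ?ZB ** (K ** ?C ** X) = mat 1"
    using X(2) by (simp add: N_def matrix_diff_rdistrib matrix_add_rdistrib matrix_mul_assoc algebra_simps)
  have right: "X ** (mat 1 - ?ZA) - X ** ?ZB ** K ** ?C = mat 1"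
    using X(3) by (simp add: N_def matrix_diff_ldistrib matrix_add_ldistrib matrix_mul_assoc algebra_simps)
  have "achievable A B C X (X ** ?ZB ** K) (K ** ?C ** X) (K ** ?C ** (X ** ?ZB ** K) + K)"
    unfolding achievable_iff
  proof (intro conjI)
    show "causal X" "causal (X ** ?ZB ** K)" "causal (K ** ?C ** X)"
      "causal (K ** ?C ** (X ** ?ZB ** K) + K)"
      by (intro causal_add causal_mult X K causal_blkdiag strictly_causal_imp_causal[OF ZB]
        strictly_causal_imp_causal[OF strictly_causal_downshift])+
    show "(mat 1 - ?ZA) ** X - ?ZB ** (K ** ?C ** X) = mat 1" by (rule left)
    show "X ** (mat 1 - ?ZA) - X ** ?ZB ** K ** ?C = mat 1" by (rule right)
    have "(mat 1 - ?ZA) ** (X ** ?ZB ** K) - ?ZB ** (K ** ?C ** (X ** ?ZB ** K) + K) =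
        ((mat 1 - ?ZA) ** X - ?ZB ** (K ** ?C ** X)) ** (?ZB ** K) - ?ZB ** K"
      by (simp add: matrix_diff_rdistrib matrix_add_ldistrib matrix_mul_assoc)
    then show "(mat 1 - ?ZA) ** (X ** ?ZB ** K) - ?ZB ** (K ** ?C ** (X ** ?ZB ** K) + K) = 0"
      by (simp add: left)
    have "K ** ?C ** X ** (mat 1 - ?ZA) - (K ** ?C ** (X ** ?ZB ** K) + K) ** ?C =
        K ** ?C ** (X ** (mat 1 - ?ZA) - X ** ?ZB ** K ** ?C) - K ** ?C"
      by (simp add: matrix_diff_ldistrib matrix_add_rdistrib matrix_mul_assoc)
    then show "K ** ?C ** X ** (mat 1 - ?ZA) - (K ** ?C ** (X ** ?ZB ** K) + K) ** ?C = 0"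
      by (simp add: right)
  qed
  then show thesis using that by blast
qed

lemma psd_block_diag:
  fixes Q :: "real^'y^'y" and R :: "real^'x^'x"
  assumes "psd Q" "psd R"
  shows "psd (block_mat Q 0 0 R)"
proof -
  have "transpose 0 = (0 :: real^'y^'x)" by (simp add: vec_eq_iff transpose_def)
  then show ?thesis
    using assms psd_block_mat[of Q "0" R] by (simp add: psd_def)
qed

lemma pos_def_imp_psd: "pos_def R \<Longrightarrow> psd R"
  unfolding pos_def_def psd_def
  by (metis inner_zero_left less_imp_le order_refl)

text \<open>The running cost is the quadratic form of \<open>block_mat Q 0 0 R\<close> at the
  stacked trajectory, and the square root turns it into a squared norm.\<close>

lemma closed_loop_cost:
  assumes "psd Q" "psd R" and "causal K" "achievable A B C \<Phi>xx \<Phi>xy \<Phi>ux \<Phi>uy"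
    "K ** blkdiag C ** \<Phi>xx = \<Phi>ux" "K ** blkdiag C ** \<Phi>xy + K = \<Phi>uy"
  defines "F \<equiv> psd_sqrt (block_mat Q 0 0 R) ** block_mat \<Phi>xx \<Phi>xy \<Phi>ux \<Phi>uy"
  shows "control_cost A B C Q R K P = (\<integral>\<^sup>+\<xi>. ennreal ((F *v \<xi>) \<bullet> (F *v \<xi>)) \<partial>P)"
  unfolding control_cost_def
proof (rule nn_integral_cong)
  fix \<xi>
  obtain x u where xu: "trajectory A B C K \<xi> = (x, u)"
    "block_mat \<Phi>xx \<Phi>xy \<Phi>ux \<Phi>uy *v \<xi> = vjoin x u"
    using trajectory_response[OF assms(3-6)] .
  have "(F *v \<xi>) \<bullet> (F *v \<xi>) = x \<bullet> (Q *v x) + u \<bullet> (R *v u)"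
    using psd_sqrt_inner[OF psd_block_diag[OF assms(1,2)], of "vjoin x u"]
    by (simp add: F_def matrix_vector_mul_assoc[symmetric] xu(2) block_mat_vjoin inner_vjoin)
  then show "(case trajectory A B C K \<xi> of (x, u) \<Rightarrow> ennreal (x \<bullet> (Q *v x) + u \<bullet> (R *v u))) =
      ennreal ((F *v \<xi>) \<bullet> (F *v \<xi>))"
    by (simp add: xu(1))
qed

section \<open>Weak duality over the Wasserstein ball\<close>

lemma sum_centered: "(\<Sum>k\<in>UNIV. centered \<xi> k) = 0"
  by (simp add: centered_def sum_subtractf sum_constant_scaleR)

lemma ennreal_sqrt_le_iff:
  assumes "0 \<le> r"
  shows "ennreal_sqrt a \<le> ennreal r \<longleftrightarrow> a \<le> ennreal (r\<^sup>2)"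
proof (cases a)
  case (real b)
  then have "sqrt b \<le> r \<longleftrightarrow> b \<le> r\<^sup>2"
    using assms by (metis real_le_lsqrt real_sqrt_le_iff real_sqrt_unique)
  then show ?thesis using real assms by (simp add: ennreal_sqrt_def)
qed (simp add: ennreal_sqrt_def top_unique)

lemma sets_centered_empirical [measurable_cong]: "sets (centered_empirical \<xi>) = sets borel"
  by (simp add: centered_empirical_def)

lemma measurable_uniform_count [measurable]:
  "f \<in> measurable (uniform_count_measure UNIV) borel"
  by (simp add: measurable_def)

lemma prob_space_centered_empirical:
  fixes \<xi> :: "'k::finite \<Rightarrow> 'a::euclidean_space"
  shows "prob_space (centered_empirical \<xi>)"
  unfolding centered_empirical_def
  by (intro prob_space.prob_space_distr prob_space_uniform_count_measure) auto

lemma integral_centered_empirical: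
  fixes \<xi> :: "'k::finite \<Rightarrow> 'a::euclidean_space" and f :: "'a \<Rightarrow> real"
  assumes "f \<in> borel_measurable borel"
  shows "(\<integral>a. f a \<partial>centered_empirical \<xi>) = (1 / real CARD('k)) * (\<Sum>k\<in>UNIV. f (centered \<xi> k))"
  unfolding centered_empirical_def using assms
  by (subst integral_distr) (auto simp: integral_uniform_count_measure)

text \<open>Integrate \<open>bound\<close> against the coupling: the multipliers average over the
  samples, the term in \<open>\<nu>\<close> vanishes because \<open>P\<close> has zero mean, and the
  quadratic term is at most \<open>l * c\<close>.\<close>

lemma coupling_bound:
  fixes \<xi> :: "'k::finite \<Rightarrow> 'a::euclidean_space" and q :: "'a \<Rightarrow> real"
  assumes P: "P \<in> zero_mean_probs" and \<gamma>: "\<gamma> \<in> couplings (centered_empirical \<xi>) P"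
    and cost: "(\<integral>\<^sup>+z. ennreal ((norm (fst z - snd z))\<^sup>2) \<partial>\<gamma>) \<le> ennreal c" "0 \<le> c"
    and l: "0 \<le> l" and q: "q \<in> borel_measurable borel" "\<And>x. 0 \<le> q x"
    and bound: "\<And>k x. q x \<le> s k + \<nu> \<bullet> x + l * (norm (x - centered \<xi> k))\<^sup>2"
  shows "(\<integral>\<^sup>+x. ennreal (q x) \<partial>P) \<le> ennreal (l * c + (1 / real CARD('k)) * (\<Sum>k\<in>UNIV. s k))"
proof -
  define \<mu> where "\<mu> = centered_empirical \<xi>"
  define I where "I = range (centered \<xi>)"
  \<comment> \<open>Distinct indices may share an atom, so the multipliers are made a function of the atom.\<close>
  define \<tau> where "\<tau> b = Min (s ` {k. centered \<xi> k = b})" for b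
  define \<sigma> where "\<sigma> a = (\<Sum>b\<in>I. \<tau> b * indicator {b} a)" for a
  have finI: "finite I" by (simp add: I_def)
  have \<sigma>I: "\<sigma> a = \<tau> a" if "a \<in> I" for a
    using finI that by (simp add: \<sigma>_def indicator_def if_distrib sum.delta cong: if_cong)
  have [measurable]: "\<sigma> \<in> borel_measurable borel" unfolding \<sigma>_def by measurable
  have \<tau>_le: "\<tau> (centered \<xi> k) \<le> s k" for k
    unfolding \<tau>_def by (intro Min_le) auto
  have \<tau>_in: "\<exists>k. centered \<xi> k = a \<and> \<tau> a = s k" if "a \<in> I" for a
  proof -
    have "{k. centered \<xi> k = a} \<noteq> {}" using that by (auto simp: I_def)
    then have "\<tau> a \<in> s ` {k. centered \<xi> k = a}"
      unfolding \<tau>_def by (intro Min_in) auto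
    then show ?thesis by auto
  qed
  have [measurable_cong]: "sets P = sets borel" "sets \<mu> = sets borel"
    and P': "prob_space P" "integrable P (\<lambda>x. x)" "(\<integral>x. x \<partial>P) = 0"
    using P by (auto simp: zero_mean_probs_def \<mu>_def sets_centered_empirical)
  have sets_\<gamma> [measurable_cong]: "sets \<gamma> = sets (borel \<Otimes>\<^sub>M borel)"
    and fst_\<gamma>: "distr \<gamma> \<mu> fst = \<mu>" and snd_\<gamma>: "distr \<gamma> P snd = P"
    using \<gamma> P unfolding couplings_def \<mu>_def[symmetric]
    by (auto simp: \<mu>_def sets_centered_empirical zero_mean_probs_def intro!: sets_pair_measure_cong)
  have mfst [measurable]: "fst \<in> measurable \<gamma> \<mu>" and msnd [measurable]: "snd \<in> measurable \<gamma> P"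
    by measurable
  interpret \<mu>: prob_space \<mu>
    unfolding \<mu>_def by (rule prob_space_centered_empirical)
  interpret \<gamma>: prob_space \<gamma>
    by (rule prob_space_distrD[OF mfst]) (simp add: fst_\<gamma> \<mu>.prob_space_axioms)
  \<comment> \<open>Since \<open>\<sigma>\<close> agrees with \<open>\<tau>\<close> only on the
    atoms, the bound on \<open>q\<close> can be used only almost everywhere.\<close>
  have "AE a in \<mu>. a \<in> I"
    unfolding \<mu>_def centered_empirical_def I_def
    by (subst AE_distr_iff) (auto simp: finite_imp_closed intro!: borel_closed)
  then have AEI: "AE z in \<gamma>. fst z \<in> I"
    by (intro AE_distrD[OF mfst, of "\<lambda>a. a \<in> I"]) (simp only: fst_\<gamma>)
  define g where "g z = \<sigma> (fst z) + \<nu> \<bullet> snd z + l * (norm (fst z - snd z))\<^sup>2" for z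
  have le_g: "AE z in \<gamma>. q (snd z) \<le> g z"
    using AEI
  proof eventually_elim
    case (elim z)
    then obtain k where "centered \<xi> k = fst z" "\<tau> (fst z) = s k" using \<tau>_in by blast
    then show ?case
      using bound[of "snd z" k] \<sigma>I[OF elim] by (simp add: g_def norm_minus_commute)
  qed
  have mcost [measurable]: "(\<lambda>z. (norm (fst z - snd z))\<^sup>2) \<in> borel_measurable \<gamma>"
    by measurable
  have int_cost: "integrable \<gamma> (\<lambda>z. (norm (fst z - snd z))\<^sup>2)"
    using cost by (intro integrableI_nonneg mcost) (auto simp: le_less_trans)
  then have "ennreal (\<integral>z. (norm (fst z - snd z))\<^sup>2 \<partial>\<gamma>) \<le> ennreal c"
    using cost(1) by (subst nn_integral_eq_integral[symmetric]) auto
  then have cost': "(\<integral>z. (norm (fst z - snd z))\<^sup>2 \<partial>\<gamma>) \<le> c"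
    using cost(2) by simp
  have int_snd: "integrable \<gamma> snd" and mean: "(\<integral>z. snd z \<partial>\<gamma>) = 0"
    using P'(2,3) integrable_distr_eq[OF msnd, of "\<lambda>x. x"] integral_distr[OF msnd, of "\<lambda>x. x"]
    by (simp_all add: snd_\<gamma>)
  have \<sigma>_bound: "norm (\<sigma> a) \<le> (\<Sum>b\<in>I. \<bar>\<tau> b\<bar>)" for a
    unfolding \<sigma>_def real_norm_def
    by (rule order_trans[OF sum_abs]) (auto intro!: sum_mono simp: indicator_def)
  have int_\<sigma>: "integrable \<mu> \<sigma>"
    using \<open>\<sigma> \<in> borel_measurable borel\<close>
    by (intro \<mu>.integrable_const_bound[where B = "\<Sum>b\<in>I. \<bar>\<tau> b\<bar>"]) (auto simp: \<sigma>_bound[unfolded real_norm_def] measurable_cong_sets[OF \<open>sets \<mu> = sets borel\<close> refl])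
  have int_\<sigma>': "integrable \<gamma> (\<lambda>z. \<sigma> (fst z))"
    and int_eq: "(\<integral>z. \<sigma> (fst z) \<partial>\<gamma>) = (\<integral>a. \<sigma> a \<partial>\<mu>)"
    using int_\<sigma> integrable_distr_eq[OF mfst, of \<sigma>] integral_distr[OF mfst, of \<sigma>]
    by (simp_all add: fst_\<gamma>)
  have int_g: "integrable \<gamma> g"
    unfolding g_def using int_\<sigma>' int_snd int_cost by auto
  have "(\<integral>z. g z \<partial>\<gamma>) = (\<integral>a. \<sigma> a \<partial>\<mu>) + \<nu> \<bullet> (\<integral>z. snd z \<partial>\<gamma>) + l * (\<integral>z. (norm (fst z - snd z))\<^sup>2 \<partial>\<gamma>)"
    unfolding g_def using int_\<sigma>' int_snd int_cost by (simp add: int_eq)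
  also have "(\<integral>a. \<sigma> a \<partial>\<mu>) = (1 / real CARD('k)) * (\<Sum>k\<in>UNIV. \<sigma> (centered \<xi> k))"
    unfolding \<mu>_def by (rule integral_centered_empirical) measurable
  \<comment> \<open>Only an inequality: for indices sharing an atom, \<open>\<tau>\<close> is the
    least of their multipliers.\<close>
  also have "\<dots> \<le> (1 / real CARD('k)) * (\<Sum>k\<in>UNIV. s k)"
    by (intro mult_left_mono sum_mono) (use \<tau>_le in \<open>auto simp: \<sigma>I I_def\<close>)
  finally have g_le: "(\<integral>z. g z \<partial>\<gamma>) \<le> l * c + (1 / real CARD('k)) * (\<Sum>k\<in>UNIV. s k)"
    using mult_left_mono[OF cost' l] by (simp add: mean)
  have "(\<integral>\<^sup>+x. ennreal (q x) \<partial>P) = (\<integral>\<^sup>+z. ennreal (q (snd z)) \<partial>\<gamma>)"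
    using q(1) by (subst snd_\<gamma>[symmetric], subst nn_integral_distr)
      (auto simp: measurable_cong_sets[OF \<open>sets P = sets borel\<close> refl])
  also have "\<dots> \<le> (\<integral>\<^sup>+z. ennreal (g z) \<partial>\<gamma>)"
    using le_g by (intro nn_integral_mono_AE) (auto elim!: eventually_mono intro: ennreal_leI)
  also have "\<dots> = ennreal (\<integral>z. g z \<partial>\<gamma>)"
  proof (rule nn_integral_eq_integral[OF int_g])
    show "AE z in \<gamma>. 0 \<le> g z"
      using le_g by eventually_elim (use q(2) order_trans in blast)
  qed
  finally show ?thesis using g_le ennreal_leI order_trans by blast
qed

text \<open>An optimal coupling is avoided: a nearly optimal one costs at most
  \<open>\<rho>\<^sup>2 + r\<close>, and the excess \<open>l * r\<close> is arbitrarily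
  small.\<close>

lemma wasserstein_weak_duality:
  fixes \<xi> :: "'k::finite \<Rightarrow> 'a::euclidean_space" and q :: "'a \<Rightarrow> real"
  assumes P: "P \<in> wasserstein_ball \<rho> (centered_empirical \<xi>)" and \<rho>: "0 < \<rho>" and l: "0 \<le> l"
    and q: "q \<in> borel_measurable borel" "\<And>x. 0 \<le> q x"
    and bound: "\<And>k x. q x \<le> s k + \<nu> \<bullet> x + l * (norm (x - centered \<xi> k))\<^sup>2"
  shows "(\<integral>\<^sup>+x. ennreal (q x) \<partial>P) \<le> ennreal (l * \<rho>\<^sup>2 + (1 / real CARD('k)) * (\<Sum>k\<in>UNIV. s k))"
    (is "_ \<le> ennreal ?v")
proof (rule ennreal_le_epsilon)
  fix e :: real assume e: "0 < e"
  \<comment> \<open>The denominator \<open>l + 1\<close> keeps \<open>l * r \<le> e\<close> while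
    allowing \<open>l = 0\<close>.\<close>
  define r where "r = e / (l + 1)"
  have r: "0 < r" "l * r \<le> e"
    using e l by (auto simp: r_def field_simps)
  have "(INF \<gamma>\<in>couplings (centered_empirical \<xi>) P. \<integral>\<^sup>+z. ennreal ((norm (fst z - snd z))\<^sup>2) \<partial>\<gamma>)
      \<le> ennreal (\<rho>\<^sup>2)"
    using P \<rho> by (simp add: wasserstein_ball_def wasserstein2_def ennreal_sqrt_le_iff)
  also have "\<dots> < ennreal (\<rho>\<^sup>2 + r)"
    using r by (intro ennreal_lessI) (auto intro: add_nonneg_pos)
  finally obtain \<gamma> where \<gamma>: "\<gamma> \<in> couplings (centered_empirical \<xi>) P"
    "(\<integral>\<^sup>+z. ennreal ((norm (fst z - snd z))\<^sup>2) \<partial>\<gamma>) < ennreal (\<rho>\<^sup>2 + r)"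
    unfolding INF_less_iff by blast
  have "(\<integral>\<^sup>+x. ennreal (q x) \<partial>P) \<le>
      ennreal (l * (\<rho>\<^sup>2 + r) + (1 / real CARD('k)) * (\<Sum>k\<in>UNIV. s k))"
    using P r by (intro coupling_bound[OF _ \<gamma>(1) less_imp_le[OF \<gamma>(2)] _ l q bound])
      (auto simp: wasserstein_ball_def)
  also have "\<dots> \<le> ennreal (?v + e)"
    using r by (intro ennreal_leI) (simp add: algebra_simps)
  \<comment> \<open>\<open>ennreal\<close> truncates negative reals to 0, so the sign of
    \<open>?v\<close> has to be distinguished.\<close>
  also have "\<dots> \<le> ennreal ?v + ennreal e"
    using e by (cases "0 \<le> ?v") (auto simp: ennreal_neg intro: ennreal_leI)
  finally show "(\<integral>\<^sup>+x. ennreal (q x) \<partial>P) \<le> ennreal ?v + ennreal e" .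
qed

section \<open>Strong duality over the Wasserstein ball\<close>

lemma sum_UNIV_bool_prod:
  fixes f :: "'k::finite \<times> bool \<Rightarrow> 'c::comm_monoid_add"
  shows "(\<Sum>z\<in>UNIV. f z) = (\<Sum>k\<in>UNIV. f (k, True) + f (k, False))"
proof -
  have "(\<Sum>z\<in>UNIV. f z) = (\<Sum>z\<in>UNIV \<times> UNIV. f z)" by simp
  also have "\<dots> = (\<Sum>k\<in>UNIV. \<Sum>b\<in>UNIV. f (k, b))"
    by (simp only: sum.cartesian_product split_def prod.collapse)
  finally show ?thesis by (simp add: UNIV_bool add.commute)
qed

lemma nn_integral_uniform_count:
  fixes f :: "'i::finite \<Rightarrow> real"
  assumes "\<And>i. 0 \<le> f i"
  shows "(\<integral>\<^sup>+i. ennreal (f i) \<partial>uniform_count_measure UNIV) = ennreal ((1 / real CARD('i)) * (\<Sum>i\<in>UNIV. f i))"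
  using assms
  by (simp add: uniform_count_measure_def nn_integral_point_measure_finite sum_distrib_left
      ennreal_mult[symmetric] sum_ennreal)

text \<open>Doubling the index set halves the weights, so forgetting the sign bit recovers the
  original law. This yields the first marginal of the coupling built next.\<close>

lemma distr_uniform_count_fst:
  fixes g :: "'k::finite \<Rightarrow> 'a::euclidean_space"
  shows "distr (uniform_count_measure (UNIV :: ('k \<times> bool) set)) borel (\<lambda>z. g (fst z)) =
    distr (uniform_count_measure UNIV) borel g"
proof (rule measure_eqI)
  fix E assume "E \<in> sets (distr (uniform_count_measure (UNIV :: ('k \<times> bool) set)) borel (\<lambda>z. g (fst z)))"
  then have E: "E \<in> sets borel" by simp
  have ind: "emeasure (distr (uniform_count_measure UNIV) borel h) E =
      ennreal ((1 / real CARD('i)) * (\<Sum>i\<in>UNIV. indicator E (h i)))" for h :: "'i::finite \<Rightarrow> 'a"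
  proof -
    have "emeasure (distr (uniform_count_measure UNIV) borel h) E =
        (\<integral>\<^sup>+x. ennreal (indicator E x) \<partial>distr (uniform_count_measure UNIV) borel h)"
      using E by (simp add: ennreal_indicator)
    also have "\<dots> = (\<integral>\<^sup>+i. ennreal (indicator E (h i)) \<partial>uniform_count_measure UNIV)"
      using E by (subst nn_integral_distr) auto
    finally show ?thesis by (simp add: nn_integral_uniform_count)
  qed
  show "emeasure (distr (uniform_count_measure (UNIV :: ('k \<times> bool) set)) borel (\<lambda>z. g (fst z))) E =
      emeasure (distr (uniform_count_measure UNIV) borel g) E"
    by (simp add: ind sum_UNIV_bool_prod sum.distrib[symmetric] sum_distrib_left[symmetric]
        flip: mult_2)
qed simp

text \<open>Each sample atom is split in half and sent to \<open>y k + e\<close> and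
  \<open>y k - e\<close>, the boolean recording the sign. The symmetry keeps the mean at zero and
  cancels the cross terms, so the shift adds exactly \<open>(norm e)\<^sup>2\<close> to the
  transport cost.\<close>

lemma symmetric_transport:
  fixes \<xi> y :: "'k::finite \<Rightarrow> 'a::euclidean_space" and e :: 'a
  assumes sum0: "(\<Sum>k\<in>UNIV. y k) = 0" and \<rho>: "0 < \<rho>"
    and cost: "(1 / real CARD('k)) * (\<Sum>k\<in>UNIV. (norm (y k - centered \<xi> k))\<^sup>2) + (norm e)\<^sup>2 \<le> \<rho>\<^sup>2"
  obtains P where "P \<in> wasserstein_ball \<rho> (centered_empirical \<xi>)"
    "\<And>f. f \<in> borel_measurable borel \<Longrightarrow> (\<And>x. 0 \<le> f x) \<Longrightarrow> (\<integral>\<^sup>+x. ennreal (f x) \<partial>P) =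
      ennreal ((1 / real CARD('k)) * (\<Sum>k\<in>UNIV. (f (y k + e) + f (y k - e)) / 2))"
proof -
  define U where "U = uniform_count_measure (UNIV :: ('k \<times> bool) set)"
  define h where "h = (\<lambda>(k, b). y k + (if b then e else - e))"
  define P where "P = distr U borel h"
  define \<gamma> where "\<gamma> = distr U (borel \<Otimes>\<^sub>M borel) (\<lambda>z. (centered \<xi> (fst z), h z))"
  have U: "prob_space U"
    unfolding U_def by (intro prob_space_uniform_count_measure) auto
  have mh [measurable]: "h \<in> borel_measurable U"
    and mp: "(\<lambda>z. (centered \<xi> (fst z), h z)) \<in> measurable U (borel \<Otimes>\<^sub>M borel)"
    by (auto simp: U_def measurable_def space_pair_measure)
  have avg: "(1 / real CARD('k \<times> bool)) *\<^sub>R (\<Sum>z\<in>UNIV. f z) =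
      (1 / real CARD('k)) *\<^sub>R (\<Sum>k\<in>UNIV. (1/2) *\<^sub>R (f (k, True) + f (k, False)))"
    for f :: "'k \<times> bool \<Rightarrow> 'c::real_vector"
    by (simp add: sum_UNIV_bool_prod scaleR_sum_right[symmetric] card_prod)
  have int_f: "(\<integral>\<^sup>+x. ennreal (f x) \<partial>P) =
      ennreal ((1 / real CARD('k)) * (\<Sum>k\<in>UNIV. (f (y k + e) + f (y k - e)) / 2))"
    if "f \<in> borel_measurable borel" "\<And>x. 0 \<le> f x" for f
  proof -
    have "(\<integral>\<^sup>+x. ennreal (f x) \<partial>P) = (\<integral>\<^sup>+z. ennreal (f (h z)) \<partial>U)"
      using that(1) unfolding P_def by (subst nn_integral_distr) auto
    also have "\<dots> = ennreal ((1 / real CARD('k \<times> bool)) * (\<Sum>z\<in>UNIV. f (h z)))"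
      unfolding U_def using that(2) by (rule nn_integral_uniform_count)
    finally show ?thesis
      using avg[of "\<lambda>z. f (h z)"] by (simp add: h_def)
  qed
  have "integrable U h"
    unfolding U_def uniform_count_measure_def by (simp add: integrable_point_measure_finite)
  then have "integrable P (\<lambda>x. x)"
    unfolding P_def by (subst integrable_distr_eq) auto
  moreover have "(\<integral>x. x \<partial>P) = (\<integral>z. h z \<partial>U)"
    unfolding P_def by (subst integral_distr) auto
  moreover have "(\<integral>z. h z \<partial>U) = (1 / real CARD('k \<times> bool)) *\<^sub>R (\<Sum>z\<in>UNIV. h z)"
    unfolding U_def uniform_count_measure_def
    by (simp add: lebesgue_integral_point_measure_finite scaleR_sum_right)
  moreover have "\<dots> = 0"
    unfolding avg h_def by (simp add: sum0 flip: scaleR_2)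
  moreover have "prob_space P"
    unfolding P_def by (rule prob_space.prob_space_distr[OF U mh])
  ultimately have "P \<in> zero_mean_probs"
    by (simp add: zero_mean_probs_def P_def)
  moreover have "wasserstein2 (centered_empirical \<xi>) P \<le> ennreal \<rho>"
  proof -
    have "distr \<gamma> (centered_empirical \<xi>) fst = distr \<gamma> borel fst"
      by (rule distr_cong) (auto simp: sets_centered_empirical)
    also have "\<dots> = distr U borel (\<lambda>z. centered \<xi> (fst z))"
      unfolding \<gamma>_def by (subst distr_distr[OF measurable_fst mp]) (simp add: o_def)
    also have "\<dots> = centered_empirical \<xi>"
      by (simp add: U_def distr_uniform_count_fst centered_empirical_def)
    finally have fst: "distr \<gamma> (centered_empirical \<xi>) fst = centered_empirical \<xi>" .
    have "distr \<gamma> P snd = distr \<gamma> borel snd"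
      by (rule distr_cong) (auto simp: P_def)
    also have "\<dots> = P"
      unfolding \<gamma>_def P_def by (subst distr_distr[OF measurable_snd mp]) (simp add: o_def)
    finally have "\<gamma> \<in> couplings (centered_empirical \<xi>) P"
      using fst by (auto simp: couplings_def \<gamma>_def P_def sets_centered_empirical intro!: sets_pair_measure_cong)
    then have "(INF \<gamma>\<in>couplings (centered_empirical \<xi>) P. \<integral>\<^sup>+z. ennreal ((norm (fst z - snd z))\<^sup>2) \<partial>\<gamma>)
        \<le> (\<integral>\<^sup>+z. ennreal ((norm (fst z - snd z))\<^sup>2) \<partial>\<gamma>)"
      by (rule INF_lower)
    also have "\<dots> = (\<integral>\<^sup>+z. ennreal ((norm (centered \<xi> (fst z) - h z))\<^sup>2) \<partial>U)"
      unfolding \<gamma>_def by (subst nn_integral_distr[OF mp]) simp_all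
    also have "\<dots> = ennreal ((1 / real CARD('k \<times> bool)) * (\<Sum>z\<in>UNIV. (norm (centered \<xi> (fst z) - h z))\<^sup>2))"
      unfolding U_def by (rule nn_integral_uniform_count) simp
    also have "(1 / real CARD('k \<times> bool)) * (\<Sum>z\<in>UNIV. (norm (centered \<xi> (fst z) - h z))\<^sup>2) =
        (1 / real CARD('k)) * (\<Sum>k\<in>UNIV. (norm (y k - centered \<xi> k))\<^sup>2 + (norm e)\<^sup>2)"
    proof -
      \<comment> \<open>The parallelogram law.\<close>
      have "(1/2) * ((norm (c - (v + e)))\<^sup>2 + (norm (c - (v - e)))\<^sup>2) = (norm (v - c))\<^sup>2 + (norm e)\<^sup>2"
        for c v :: 'a
        by (simp add: power2_norm_eq_inner inner_diff_left inner_diff_right inner_add_left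
            inner_add_right inner_commute field_simps)
      then show ?thesis
        using avg[of "\<lambda>z. (norm (centered \<xi> (fst z) - h z))\<^sup>2"]
        by (simp add: h_def add_divide_distrib)
    qed
    also have "\<dots> = (1 / real CARD('k)) * (\<Sum>k\<in>UNIV. (norm (y k - centered \<xi> k))\<^sup>2) + (norm e)\<^sup>2"
      by (simp add: sum.distrib distrib_left)
    finally show ?thesis
      using cost \<rho> by (simp add: wasserstein2_def ennreal_sqrt_le_iff) (meson ennreal_leI order_trans)
  qed
  ultimately have "P \<in> wasserstein_ball \<rho> (centered_empirical \<xi>)"
    by (simp add: wasserstein_ball_def)
  then show thesis using that int_f by blast
qed

text \<open>\<open>D l\<close> stands for \<open>(l I - M)\<^sup>-\<^sup>1 M\<close>. It gives the
  displacement of a sample: \<open>c + D l c = l (l I - M)\<^sup>-\<^sup>1 c\<close>. The norm bound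
  makes displacements small for large \<open>l\<close>, and continuity in \<open>l\<close> prepares
  the intermediate value theorem.\<close>

lemma resolvent:
  fixes M :: "real^'d^'d"
  assumes sym: "transpose M = M" and max: "\<And>x. x \<bullet> (M *v x) \<le> \<mu> * (norm x)\<^sup>2"
  obtains D where "\<And>l v. \<mu> < l \<Longrightarrow> l *\<^sub>R D l v - M *v D l v = M *v v"
    "\<And>l. \<mu> < l \<Longrightarrow> linear (D l)"
    "\<And>l v. \<mu> < l \<Longrightarrow> (l - \<mu>) * norm (D l v) \<le> norm (M *v v)"
    "\<And>v. continuous_on {\<mu><..} (\<lambda>l. D l v)"
proof -
  define G where "G l = l *\<^sub>R mat 1 - M" for l
  have G: "G l *v x = l *\<^sub>R x - M *v x" for l x
    by (simp add: G_def matrix_vector_mult_diff_rdistrib scaleR_matrix_vector_assoc[symmetric])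
  \<comment> \<open>The Rayleigh bound gives coercivity of \<open>l I - M\<close>, and
    Cauchy-Schwarz turns it into a lower bound on the norm.\<close>
  have coercive: "(l - \<mu>) * norm x \<le> norm (G l *v x)" for l x
  proof (cases "x = 0")
    case False
    have "(l - \<mu>) * norm x * norm x \<le> x \<bullet> (G l *v x)"
      using max[of x] by (simp add: G inner_diff_right power2_norm_eq_inner[symmetric] power2_eq_square algebra_simps)
    also have "\<dots> \<le> norm (G l *v x) * norm x"
      by (metis norm_cauchy_schwarz mult.commute)
    finally show ?thesis using False by simp
  qed simp
  have "\<exists>H. G l ** H = mat 1" if "\<mu> < l" for l
  proof -
    have "x = 0" if "G l *v x = 0" for x
      using coercive[of l x] that \<open>\<mu> < l\<close> by (simp add: mult_le_0_iff)
    then have "inj ((*v) (G l))" by (subst linear_injective_0) auto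
    then show ?thesis
      by (metis matrix_left_invertible_injective matrix_left_right_inverse)
  qed
  then obtain H where H: "G l ** H l = mat 1" if "\<mu> < l" for l by metis
  define D where "D l v = H l *v (M *v v)" for l v
  have GD: "G l *v D l v = M *v v" if "\<mu> < l" for l v
    by (simp add: D_def matrix_vector_mul_assoc H that matrix_mul_assoc)
  have bd: "(l - \<mu>) * norm (D l v) \<le> norm (M *v v)" if "\<mu> < l" for l v
    using coercive[of l "D l v"] GD[OF that] by simp
  have cont: "continuous_on {\<mu><..} (\<lambda>l. D l v)" for v
    unfolding continuous_on_def
  proof
    fix a assume a: "a \<in> {\<mu><..}"
    \<comment> \<open>By the resolvent identity, \<open>G l\<close> maps
      \<open>D l v - D a v\<close> to \<open>(a - l) *\<^sub>R D a v\<close>; coercivity gives an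
      estimate that tends to 0 as \<open>l\<close> tends to \<open>a\<close>.\<close>
    have ev: "\<forall>\<^sub>F l in at a within {\<mu><..}. norm (D l v - D a v) \<le> \<bar>a - l\<bar> * norm (D a v) / (l - \<mu>)"
    proof (rule eventually_at_topological[THEN iffD2], intro exI conjI ballI impI)
      show "open {\<mu><..}" "a \<in> {\<mu><..}" using a by auto
      fix l assume "l \<in> {\<mu><..}"
      then have l: "\<mu> < l" by simp
      have "G l *v (D l v - D a v) = M *v v - G l *v D a v"
        by (simp add: matrix_vector_mult_diff_distrib GD l)
      also have "\<dots> = G a *v D a v - G l *v D a v"
        using a by (simp add: GD)
      also have "\<dots> = (a - l) *\<^sub>R D a v"
        by (simp add: G algebra_simps)
      finally have "(l - \<mu>) * norm (D l v - D a v) \<le> \<bar>a - l\<bar> * norm (D a v)"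
        using coercive[of l "D l v - D a v"] by simp
      then show "norm (D l v - D a v) \<le> \<bar>a - l\<bar> * norm (D a v) / (l - \<mu>)"
        using l by (simp add: field_simps)
    qed
    have "((\<lambda>l. \<bar>a - l\<bar> * norm (D a v) / (l - \<mu>)) \<longlongrightarrow> \<bar>a - a\<bar> * norm (D a v) / (a - \<mu>)) (at a within {\<mu><..})"
      using a by (intro tendsto_intros) auto
    then have "((\<lambda>l. \<bar>a - l\<bar> * norm (D a v) / (l - \<mu>)) \<longlongrightarrow> 0) (at a within {\<mu><..})" by simp
    from Lim_null_comparison[OF ev this]
    show "((\<lambda>l. D l v) \<longlongrightarrow> D a v) (at a within {\<mu><..})"
      by (simp add: LIM_zero_iff)
  qed
  show thesis
  proof (rule that[of D])
    show "linear (D l)" for l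
      by (intro linearI) (simp_all add: D_def matrix_vector_right_distrib matrix_vector_mult_scaleR)
  qed (use GD bd cont in \<open>auto simp: G\<close>)
qed

text \<open>For \<open>l > \<mu>\<close> the concave function
  \<open>x \<bullet> (M *v x) - l * (norm (x - c))\<^sup>2\<close> with
  \<open>c = centered \<xi> k\<close> has its maximum at \<open>y k\<close>, and the multiplier
  \<open>s k\<close> is the maximal value. The matrix condition is the dual constraint with
  \<open>\<nu> = 0\<close>.\<close>

lemma wasserstein_strong_duality:
  fixes \<xi> :: "'k::finite \<Rightarrow> real^'d" and M :: "real^'d^'d"
  assumes M: "psd M" and \<rho>: "0 < \<rho>" and \<epsilon>: "0 < \<epsilon>"
  obtains l s P where "0 \<le> l"
    "\<And>k x t. 0 \<le> l * (x \<bullet> x) - x \<bullet> (M *v x) + 2 * t * (x \<bullet> (l *\<^sub>R centered \<xi> k)) +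
      t\<^sup>2 * (s k + l * (norm (centered \<xi> k))\<^sup>2)"
    "P \<in> wasserstein_ball \<rho> (centered_empirical \<xi>)"
    "ennreal (l * \<rho>\<^sup>2 + (1 / real CARD('k)) * (\<Sum>k\<in>UNIV. s k)) \<le>
      (\<integral>\<^sup>+x. ennreal (x \<bullet> (M *v x)) \<partial>P) + ennreal \<epsilon>"
proof -
  define N where "N = real CARD('k)"
  have N: "0 < N" by (simp add: N_def)
  let ?c = "centered \<xi>"
  from M have sym: "transpose M = M" and pos: "0 \<le> x \<bullet> (M *v x)" for x by (auto simp: psd_def)
  have "(UNIV :: (real^'d) set) \<noteq> {0}"
    by (metis UNIV_I norm_axis_1 norm_zero singletonD zero_neq_one)
  then obtain e where e: "norm e = 1" and max: "\<And>x. x \<bullet> (M *v x) \<le> (e \<bullet> (M *v e)) * (norm x)\<^sup>2"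
    using symmetric_eigenvector[OF sym subspace_UNIV] by (metis UNIV_I)
  define \<mu> where "\<mu> = e \<bullet> (M *v e)"
  have \<mu>: "0 \<le> \<mu>" by (simp add: \<mu>_def pos)
  obtain D where D: "\<And>l v. \<mu> < l \<Longrightarrow> l *\<^sub>R D l v - M *v D l v = M *v v"
    "\<And>l. \<mu> < l \<Longrightarrow> linear (D l)"
    "\<And>l v. \<mu> < l \<Longrightarrow> (l - \<mu>) * norm (D l v) \<le> norm (M *v v)"
    "\<And>v. continuous_on {\<mu><..} (\<lambda>l. D l v)"
    using resolvent[OF sym max] unfolding \<mu>_def by metis
  define h where "h l = (1 / N) * (\<Sum>k\<in>UNIV. (norm (D l (?c k)))\<^sup>2)" for l
  obtain l where l: "\<mu> < l" "h l \<le> \<rho>\<^sup>2" "(l - \<mu>) * (\<rho>\<^sup>2 - h l) \<le> \<epsilon>"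
  proof -
    \<comment> \<open>Chosen so that \<open>(a - \<mu>) * \<rho>\<^sup>2 = \<epsilon>\<close>: if
      \<open>a\<close> already respects the budget, its gap is at most \<open>\<epsilon>\<close>.
      Otherwise \<open>l\<close> is increased until \<open>h l = \<rho>\<^sup>2\<close>, where the
      gap is zero.\<close>
    define a where "a = \<mu> + \<epsilon> / \<rho>\<^sup>2"
    have a: "\<mu> < a" using \<epsilon> \<rho> by (simp add: a_def)
    show thesis
    proof (cases "h a \<le> \<rho>\<^sup>2")
      case True
      have "0 \<le> h a" using N by (auto simp: h_def intro!: divide_nonneg_nonneg sum_nonneg)
      then have "(a - \<mu>) * (\<rho>\<^sup>2 - h a) \<le> (a - \<mu>) * \<rho>\<^sup>2" using a by (intro mult_left_mono) auto
      also have "\<dots> = \<epsilon>" using \<rho> by (simp add: a_def)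
      finally show thesis using that[of a] a True by simp
    next
      case False
      define S where "S = (\<Sum>k\<in>UNIV. norm (M *v ?c k))"
      \<comment> \<open>Large enough that \<open>(b - \<mu>) * \<rho>\<close> dominates every
        \<open>norm (M *v ?c k)\<close>; then each displacement is at most \<open>\<rho>\<close> and
        \<open>h b \<le> \<rho>\<^sup>2\<close>.\<close>
      define b where "b = a + S / \<rho>"
      have S: "norm (M *v ?c k) \<le> S" for k
        unfolding S_def by (intro member_le_sum) auto
      have S0: "0 \<le> S" unfolding S_def by (intro sum_nonneg) auto
      have ab: "a \<le> b" using S0 \<rho> by (simp add: b_def)
      have small: "norm (D b (?c k)) \<le> \<rho>" for k
      proof -
        have "(b - \<mu>) * norm (D b (?c k)) \<le> S" using D(3)[of b "?c k"] S[of k] a ab by simp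
        also have "S \<le> (b - \<mu>) * \<rho>" using a \<rho> by (simp add: b_def algebra_simps)
        finally show ?thesis using a ab by simp
      qed
      have "(\<Sum>k\<in>UNIV. (norm (D b (?c k)))\<^sup>2) \<le> (\<Sum>k\<in>(UNIV::'k set). \<rho>\<^sup>2)"
        using small by (intro sum_mono power_mono) auto
      then have hb: "h b \<le> \<rho>\<^sup>2" using N by (simp add: h_def N_def field_simps)
      have "continuous_on {a..b} h"
        unfolding h_def using a
        by (intro continuous_intros continuous_on_subset[OF D(4)]) auto
      then obtain x where "a \<le> x" "x \<le> b" "h x = \<rho>\<^sup>2"
        using IVT2'[of h b "\<rho>\<^sup>2" a] hb False ab by auto
      then show thesis using that[of x] a \<epsilon> by simp
    qed
  qed
  have l0: "0 \<le> l" using l \<mu> by simp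
  define y where "y k = ?c k + D l (?c k)" for k
  \<comment> \<open>The stationarity condition of the inner maximization.\<close>
  have Gy: "l *\<^sub>R y k - M *v y k = l *\<^sub>R ?c k" for k
    using D(1)[OF l(1), of "?c k"] by (simp add: y_def matrix_vector_right_distrib algebra_simps)
  have "(\<Sum>k\<in>UNIV. D l (?c k)) = D l (\<Sum>k\<in>UNIV. ?c k)"
    by (rule linear_sum[OF D(2)[OF l(1)], symmetric])
  then have y0: "(\<Sum>k\<in>UNIV. y k) = 0"
    by (simp add: y_def sum.distrib sum_centered linear_0[OF D(2)[OF l(1)]])
  \<comment> \<open>The unspent budget goes into the top eigendirection \<open>e\<close>, where it
    raises the cost by \<open>r\<^sup>2 * \<mu>\<close>.\<close>
  define r where "r = sqrt (\<rho>\<^sup>2 - h l)"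
  have r2: "r\<^sup>2 = \<rho>\<^sup>2 - h l" using l by (simp add: r_def)
  define s where "s k = y k \<bullet> (M *v y k) - l * (norm (y k - ?c k))\<^sup>2" for k
  have cost: "(1 / N) * (\<Sum>k\<in>UNIV. (norm (y k - ?c k))\<^sup>2) = h l"
    by (simp add: h_def y_def)
  have "(norm (r *\<^sub>R e))\<^sup>2 = r\<^sup>2" by (simp add: e power_mult_distrib)
  then obtain P where P: "P \<in> wasserstein_ball \<rho> (centered_empirical \<xi>)"
    and int_P: "\<And>f. f \<in> borel_measurable borel \<Longrightarrow> (\<And>x. 0 \<le> f x) \<Longrightarrow> (\<integral>\<^sup>+x. ennreal (f x) \<partial>P) =
      ennreal ((1 / N) * (\<Sum>k\<in>UNIV. (f (y k + r *\<^sub>R e) + f (y k - r *\<^sub>R e)) / 2))"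
    using symmetric_transport[OF y0 \<rho>, of \<xi> "r *\<^sub>R e"] r2 cost unfolding N_def by auto
  have "continuous_on UNIV (\<lambda>x. x \<bullet> (M *v x))"
    by (intro continuous_on_inner continuous_on_id matrix_vector_mult_linear_continuous_on)
  then have meas: "(\<lambda>x. x \<bullet> (M *v x)) \<in> borel_measurable borel"
    by (rule borel_measurable_continuous_onI)
  have "((y k + r *\<^sub>R e) \<bullet> (M *v (y k + r *\<^sub>R e)) + (y k - r *\<^sub>R e) \<bullet> (M *v (y k - r *\<^sub>R e))) / 2
      = y k \<bullet> (M *v y k) + r\<^sup>2 * \<mu>" for k
    by (simp add: \<mu>_def matrix_vector_right_distrib matrix_vector_mult_diff_distrib
        matrix_vector_mult_scaleR inner_add_left inner_add_right inner_diff_left inner_diff_right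
        power2_eq_square field_simps)
  then have "(\<integral>\<^sup>+x. ennreal (x \<bullet> (M *v x)) \<partial>P) =
      ennreal ((1 / N) * (\<Sum>k\<in>UNIV. y k \<bullet> (M *v y k) + r\<^sup>2 * \<mu>))"
    using int_P[OF meas pos] by (simp only:)
  also have "(1 / N) * (\<Sum>k\<in>UNIV. y k \<bullet> (M *v y k) + r\<^sup>2 * \<mu>) =
      (1 / N) * (\<Sum>k\<in>UNIV. y k \<bullet> (M *v y k)) + r\<^sup>2 * \<mu>"
    using N by (simp add: sum.distrib N_def distrib_left)
  finally have val: "(\<integral>\<^sup>+x. ennreal (x \<bullet> (M *v x)) \<partial>P) =
      ennreal ((1 / N) * (\<Sum>k\<in>UNIV. y k \<bullet> (M *v y k)) + r\<^sup>2 * \<mu>)" .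
  have "l * \<rho>\<^sup>2 + (1 / N) * (\<Sum>k\<in>UNIV. s k) =
      l * \<rho>\<^sup>2 + (1 / N) * (\<Sum>k\<in>UNIV. y k \<bullet> (M *v y k)) - l * ((1 / N) * (\<Sum>k\<in>UNIV. (norm (y k - ?c k))\<^sup>2))"
    by (simp add: s_def sum_subtractf sum_distrib_left[symmetric] right_diff_distrib)
  \<comment> \<open>The last summand is the duality gap between the program value and the cost of
    the constructed law.\<close>
  also have "\<dots> = (1 / N) * (\<Sum>k\<in>UNIV. y k \<bullet> (M *v y k)) + r\<^sup>2 * \<mu> + (l - \<mu>) * (\<rho>\<^sup>2 - h l)"
    unfolding cost r2 by (simp add: algebra_simps)
  also have "\<dots> \<le> (1 / N) * (\<Sum>k\<in>UNIV. y k \<bullet> (M *v y k)) + r\<^sup>2 * \<mu> + \<epsilon>"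
    using l by simp
  finally have "ennreal (l * \<rho>\<^sup>2 + (1 / N) * (\<Sum>k\<in>UNIV. s k)) \<le>
      ennreal ((1 / N) * (\<Sum>k\<in>UNIV. y k \<bullet> (M *v y k)) + r\<^sup>2 * \<mu> + \<epsilon>)"
    by (rule ennreal_leI)
  also have "\<dots> = (\<integral>\<^sup>+x. ennreal (x \<bullet> (M *v x)) \<partial>P) + ennreal \<epsilon>"
    unfolding val using N \<mu> \<epsilon> pos
    by (intro ennreal_plus) (auto intro!: add_nonneg_nonneg mult_nonneg_nonneg divide_nonneg_nonneg sum_nonneg)
  finally have le: "ennreal (l * \<rho>\<^sup>2 + (1 / real CARD('k)) * (\<Sum>k\<in>UNIV. s k)) \<le>
      (\<integral>\<^sup>+x. ennreal (x \<bullet> (M *v x)) \<partial>P) + ennreal \<epsilon>" by (simp add: N_def)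
  have lmi: "0 \<le> l * (x \<bullet> x) - x \<bullet> (M *v x) + 2 * t * (x \<bullet> (l *\<^sub>R ?c k)) +
      t\<^sup>2 * (s k + l * (norm (?c k))\<^sup>2)" for k x t
  proof -
    have G0: "0 \<le> l * (z \<bullet> z) - z \<bullet> (M *v z)" for z
    proof -
      have "z \<bullet> (M *v z) \<le> \<mu> * (z \<bullet> z)" using max[of z] by (simp add: \<mu>_def power2_norm_eq_inner)
      also have "\<dots> \<le> l * (z \<bullet> z)" using l by (intro mult_right_mono) auto
      finally show ?thesis by simp
    qed
    have xc: "x \<bullet> (l *\<^sub>R ?c k) = l * (x \<bullet> y k) - x \<bullet> (M *v y k)"
      unfolding Gy[symmetric] by (simp add: inner_diff_right)
    have "l * (y k \<bullet> ?c k) = l * (y k \<bullet> y k) - y k \<bullet> (M *v y k)"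
      using arg_cong[OF Gy[of k], of "\<lambda>v. y k \<bullet> v"] by (simp add: inner_diff_right)
    then have sk: "s k + l * (norm (?c k))\<^sup>2 = l * (y k \<bullet> y k) - y k \<bullet> (M *v y k)"
      by (simp add: s_def power2_norm_eq_inner inner_diff_left inner_diff_right inner_commute algebra_simps)
    \<comment> \<open>Replacing \<open>l *\<^sub>R ?c k\<close> by
      \<open>l *\<^sub>R y k - M *v y k\<close> collapses everything into the form of
      \<open>l I - M\<close> at \<open>x + t *\<^sub>R y k\<close>.\<close>
    have "l * (x \<bullet> x) - x \<bullet> (M *v x) + 2 * t * (x \<bullet> (l *\<^sub>R ?c k)) + t\<^sup>2 * (s k + l * (norm (?c k))\<^sup>2)
        = l * ((x + t *\<^sub>R y k) \<bullet> (x + t *\<^sub>R y k)) - (x + t *\<^sub>R y k) \<bullet> (M *v (x + t *\<^sub>R y k))"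
      unfolding xc sk using symmetric_inner[OF sym, of "y k" x]
      by (simp add: matrix_vector_right_distrib matrix_vector_mult_scaleR inner_add_left inner_add_right
          power2_eq_square algebra_simps inner_commute[of "y k" x] inner_commute[of "M *v y k" x])
    then show ?thesis using G0 by simp
  qed
  show thesis by (rule that[OF l0 lmi P le])
qed

section \<open>The semidefinite program\<close>

lemma matrix_scaleR_left: "(c *\<^sub>R A) ** B = c *\<^sub>R (A ** B)" for A :: "real^'n^'m"
  by (simp add: vec_eq_iff matrix_matrix_mult_def sum_distrib_left mult_ac)

lemma matrix_scaleR_right: "A ** (c *\<^sub>R B) = c *\<^sub>R (A ** B)" for A :: "real^'n^'m"
  by (simp add: vec_eq_iff matrix_matrix_mult_def sum_distrib_left mult_ac)

lemma transpose_combination: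
  "transpose (a *\<^sub>R A + b *\<^sub>R B) = a *\<^sub>R transpose A + b *\<^sub>R transpose B" for A :: "real^'n^'m"
  by (simp add: vec_eq_iff transpose_def)

lemma block_mat_combination:
  "block_mat (a *\<^sub>R X + b *\<^sub>R X') (a *\<^sub>R Y + b *\<^sub>R Y') (a *\<^sub>R U + b *\<^sub>R U') (a *\<^sub>R V + b *\<^sub>R V') =
    a *\<^sub>R block_mat X Y U V + b *\<^sub>R block_mat X' Y' U' V'"
  by (simp add: vec_eq_iff split_sum_all block_mat_def)

lemma causal_combination: "causal M \<Longrightarrow> causal N \<Longrightarrow> causal (a *\<^sub>R M + b *\<^sub>R N)"
  by (simp add: causal_def)

text \<open>The constraints are affine; \<open>a + b = 1\<close> preserves the right-hand sides
  \<open>mat 1\<close>.\<close>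

lemma achievable_combination:
  assumes "achievable A B C X Y U V" "achievable A B C X' Y' U' V'" and ab: "a + b = 1"
  shows "achievable A B C (a *\<^sub>R X + b *\<^sub>R X') (a *\<^sub>R Y + b *\<^sub>R Y')
    (a *\<^sub>R U + b *\<^sub>R U') (a *\<^sub>R V + b *\<^sub>R V')"
proof -
  have comb: "(M ** (a *\<^sub>R X1 + b *\<^sub>R X2)) - (N ** (a *\<^sub>R Y1 + b *\<^sub>R Y2)) =
      a *\<^sub>R (M ** X1 - N ** Y1) + b *\<^sub>R (M ** X2 - N ** Y2)"
    for M :: "real^'x^'y" and N :: "real^'z^'y" and X1 X2 :: "real^'w^'x" and Y1 Y2
    by (simp add: matrix_add_ldistrib matrix_scaleR_right algebra_simps)
  have comb': "((a *\<^sub>R X1 + b *\<^sub>R X2) ** M) - ((a *\<^sub>R Y1 + b *\<^sub>R Y2) ** N) =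
      a *\<^sub>R (X1 ** M - Y1 ** N) + b *\<^sub>R (X2 ** M - Y2 ** N)"
    for X1 X2 :: "real^'x^'y" and Y1 Y2 :: "real^'z^'y" and M :: "real^'w^'x" and N
    by (simp add: matrix_add_rdistrib matrix_scaleR_left algebra_simps)
  show ?thesis
    using assms unfolding achievable_iff comb comb'
    by (auto intro: causal_combination simp flip: scaleR_add_left)
qed

lemma sdp_feasible_iff_schur:
  fixes A :: "'t::{finite,linorder} \<Rightarrow> real^'n::finite^'n"
    and B :: "'t \<Rightarrow> real^'m::finite^'n" and C :: "'t \<Rightarrow> real^'n^'p::finite"
    and \<xi> :: "'k::finite \<Rightarrow> real^(('t \<times> 'n) + ('t \<times> 'p))"
    and Q :: "real^('t \<times> 'n)^('t \<times> 'n)" and R :: "real^('t \<times> 'm)^('t \<times> 'm)"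
  defines "F \<equiv> \<lambda>X Y U V. psd_sqrt (block_mat Q 0 0 R) ** block_mat X Y U V"
  shows "(l, s, \<nu>, P, X, Y, U, V) \<in> sdp_feasible A B C Q R \<xi> \<longleftrightarrow>
    0 \<le> l \<and> transpose P = P \<and> achievable A B C X Y U V \<and>
    (\<forall>k x t. 0 \<le> l * (x \<bullet> x) - x \<bullet> (P *v x) +
      2 * t * (x \<bullet> (- (1/2) *\<^sub>R \<nu> + l *\<^sub>R centered \<xi> k)) + t\<^sup>2 * (s $ k + l * (norm (centered \<xi> k))\<^sup>2)) \<and>
    (\<forall>y. (F X Y U V *v y) \<bullet> (F X Y U V *v y) \<le> y \<bullet> (P *v y))"
  unfolding sdp_feasible_def Let_def F_def
  by (auto simp: lmi_iff schur_iff simp del: scaleR_minus_left)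

text \<open>With the Schur complement undone, each inequality is affine in the decision variables
  once the test vectors are fixed. The convexity and closedness proofs rely on this form.\<close>

lemma sdp_feasible_iff:
  fixes A :: "'t::{finite,linorder} \<Rightarrow> real^'n::finite^'n"
    and B :: "'t \<Rightarrow> real^'m::finite^'n" and C :: "'t \<Rightarrow> real^'n^'p::finite"
    and \<xi> :: "'k::finite \<Rightarrow> real^(('t \<times> 'n) + ('t \<times> 'p))"
  shows "(l, s, \<nu>, P, X, Y, U, V) \<in> sdp_feasible A B C Q R \<xi> \<longleftrightarrow>
    0 \<le> l \<and> transpose P = P \<and> achievable A B C X Y U V \<and>
    (\<forall>k x t. 0 \<le> l * (x \<bullet> x) - x \<bullet> (P *v x) +
      2 * t * (x \<bullet> (- (1/2) *\<^sub>R \<nu> + l *\<^sub>R centered \<xi> k)) + t\<^sup>2 * (s $ k + l * (norm (centered \<xi> k))\<^sup>2)) \<and>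
    (\<forall>x y. 0 \<le> x \<bullet> x + 2 * (x \<bullet> ((psd_sqrt (block_mat Q 0 0 R) ** block_mat X Y U V) *v y)) + y \<bullet> (P *v y))"
  unfolding sdp_feasible_iff_schur schur_form[symmetric] by blast

lemma prod_cases8:
  obtains a b c d e f g h where "y = (a, b, c, d, e, f, g, h)"
proof -
  obtain a b c d e f w where "y = (a, b, c, d, e, f, w)" by (rule prod_cases7)
  moreover obtain g h where "w = (g, h)" by (cases w)
  ultimately show thesis using that by simp
qed

lemma convex_sdp_feasible: "convex (sdp_feasible A B C Q R \<xi>)"
proof (rule convexI)
  fix z z' and a b :: real
  assume zz': "z \<in> sdp_feasible A B C Q R \<xi>" "z' \<in> sdp_feasible A B C Q R \<xi>"
    and ab: "0 \<le> a" "0 \<le> b" "a + b = 1"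
  obtain l s \<nu> P X Y U V where z: "z = (l, s, \<nu>, P, X, Y, U, V)" by (rule prod_cases8)
  obtain l' s' \<nu>' P' X' Y' U' V' where z': "z' = (l', s', \<nu>', P', X', Y', U', V')" by (rule prod_cases8)
  note h = zz'[unfolded z z' sdp_feasible_iff]
  let ?L = "\<lambda>l P \<nu> s k x t. l * (x \<bullet> x) - x \<bullet> (P *v x) +
      2 * t * (x \<bullet> (- (1/2) *\<^sub>R \<nu> + l *\<^sub>R centered \<xi> k)) + t\<^sup>2 * (s $ k + l * (norm (centered \<xi> k))\<^sup>2)"
  let ?F = "\<lambda>X Y U V. psd_sqrt (block_mat Q 0 0 R) ** block_mat X Y U V"
  let ?S = "\<lambda>P X Y U V x y. x \<bullet> x + 2 * (x \<bullet> (?F X Y U V *v y)) + y \<bullet> (P *v y)"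
  have L: "?L (a * l + b * l') (a *\<^sub>R P + b *\<^sub>R P') (a *\<^sub>R \<nu> + b *\<^sub>R \<nu>') (a *\<^sub>R s + b *\<^sub>R s') k x t =
      a * ?L l P \<nu> s k x t + b * ?L l' P' \<nu>' s' k x t" for k x t
    by (simp add: inner_add_right matrix_vector_mult_add_rdistrib scaleR_matrix_vector_assoc[symmetric]
        algebra_simps)
  \<comment> \<open>The term \<open>x \<bullet> x\<close> carries no decision variable; the weight
    \<open>a + b = 1\<close> is attached so that it can be split between the two points.\<close>
  have "?S (a *\<^sub>R P + b *\<^sub>R P') (a *\<^sub>R X + b *\<^sub>R X') (a *\<^sub>R Y + b *\<^sub>R Y') (a *\<^sub>R U + b *\<^sub>R U')
      (a *\<^sub>R V + b *\<^sub>R V') x y = (a + b) * (x \<bullet> x) + 2 * a * (x \<bullet> (?F X Y U V *v y)) +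
      2 * b * (x \<bullet> (?F X' Y' U' V' *v y)) + a * (y \<bullet> (P *v y)) + b * (y \<bullet> (P' *v y))" for x y
    by (simp add: ab block_mat_combination matrix_add_ldistrib matrix_scaleR_right inner_add_right
        matrix_vector_mult_add_rdistrib scaleR_matrix_vector_assoc[symmetric] algebra_simps)
  then have S: "?S (a *\<^sub>R P + b *\<^sub>R P') (a *\<^sub>R X + b *\<^sub>R X') (a *\<^sub>R Y + b *\<^sub>R Y') (a *\<^sub>R U + b *\<^sub>R U')
      (a *\<^sub>R V + b *\<^sub>R V') x y = a * ?S P X Y U V x y + b * ?S P' X' Y' U' V' x y" for x y
    by (simp add: algebra_simps)
  have comb_nonneg: "0 \<le> a * c + b * d" if "0 \<le> c" "0 \<le> d" for c d
    using ab that by simp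
  have "(a * l + b * l', a *\<^sub>R s + b *\<^sub>R s', a *\<^sub>R \<nu> + b *\<^sub>R \<nu>', a *\<^sub>R P + b *\<^sub>R P', a *\<^sub>R X + b *\<^sub>R X',
      a *\<^sub>R Y + b *\<^sub>R Y', a *\<^sub>R U + b *\<^sub>R U', a *\<^sub>R V + b *\<^sub>R V') \<in> sdp_feasible A B C Q R \<xi>"
    unfolding sdp_feasible_iff L S
    by (intro conjI allI comb_nonneg achievable_combination ab(3))
      (use h in \<open>blast | simp add: transpose_combination\<close>)+
  then show "a *\<^sub>R z + b *\<^sub>R z' \<in> sdp_feasible A B C Q R \<xi>"
    by (simp add: z z')
qed

lemma sdp_objective_combination:
  "sdp_objective \<rho> (a *\<^sub>R z + b *\<^sub>R z') = a * sdp_objective \<rho> z + b * sdp_objective \<rho> z'"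
  by (cases z rule: prod_cases8; cases z' rule: prod_cases8)
    (simp add: sdp_objective_def sum.distrib sum_distrib_left[symmetric] add_divide_distrib algebra_simps)

lemma convex_on_sdp_objective: "convex_on (sdp_feasible A B C Q R \<xi>) (sdp_objective \<rho>)"
  by (simp add: convex_on_def convex_sdp_feasible sdp_objective_combination)

section \<open>Closedness of the feasible set\<close>

lemma continuous_on_matrix_mult [continuous_intros]:
  fixes f :: "'z::topological_space \<Rightarrow> real^'n^'m" and g :: "'z \<Rightarrow> real^'k^'n"
  assumes "continuous_on S f" "continuous_on S g"
  shows "continuous_on S (\<lambda>z. f z ** g z)"
  unfolding matrix_matrix_mult_def
  by (intro continuous_on_vec_lambda continuous_on_sum continuous_on_mult continuous_on_component assms)

lemma continuous_on_matrix_vec [continuous_intros]: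
  fixes f :: "'z::topological_space \<Rightarrow> real^'n^'m" and g :: "'z \<Rightarrow> real^'n"
  assumes "continuous_on S f" "continuous_on S g"
  shows "continuous_on S (\<lambda>z. f z *v g z)"
  unfolding matrix_vector_mult_def
  by (intro continuous_on_vec_lambda continuous_on_sum continuous_on_mult continuous_on_component assms)

lemma continuous_on_transpose [continuous_intros]:
  fixes f :: "'z::topological_space \<Rightarrow> real^'n^'m"
  assumes "continuous_on S f"
  shows "continuous_on S (\<lambda>z. transpose (f z))"
  unfolding transpose_def
  by (intro continuous_on_vec_lambda continuous_on_component assms)

lemma continuous_on_sum_vec:
  fixes f :: "'z::topological_space \<Rightarrow> 'c::topological_space^('a::finite + 'b::finite)"
  assumes "\<And>a. continuous_on S (\<lambda>z. f z $ Inl a)" "\<And>b. continuous_on S (\<lambda>z. f z $ Inr b)"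
  shows "continuous_on S f"
proof -
  have "continuous_on S (\<lambda>z. f z $ i)" for i
    using assms by (cases i) auto
  then have "continuous_on S (\<lambda>z. \<chi> i. f z $ i)"
    by (intro continuous_on_vec_lambda)
  then show ?thesis by simp
qed

lemma continuous_on_block_mat [continuous_intros]:
  assumes "continuous_on S f11" "continuous_on S f12" "continuous_on S f21" "continuous_on S f22"
  shows "continuous_on S (\<lambda>z. block_mat (f11 z) (f12 z) (f21 z) (f22 z))"
  unfolding block_mat_def using assms
  by (intro continuous_on_sum_vec) (auto intro!: continuous_on_component)

lemma closed_sdp_feasible: "closed (sdp_feasible A B C Q R \<xi>)"
proof -
  have "closed {z. case z of (l, s, \<nu>, P, X, Y, U, V) \<Rightarrow> (l, s, \<nu>, P, X, Y, U, V) \<in> sdp_feasible A B C Q R \<xi>}"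
    \<comment> \<open>The premise \<open>t < s\<close> in \<open>causal_def\<close> does not depend
      on the point, so as a disjunction the implication is a union of two closed conditions.\<close>
    unfolding sdp_feasible_iff achievable_iff causal_def case_prod_unfold imp_conv_disj
    by (intro closed_Collect_conj closed_Collect_all closed_Collect_disj closed_Collect_le
        closed_Collect_eq closed_Collect_const continuous_intros continuous_on_component)
  then show ?thesis by (simp add: case_prod_unfold)
qed

section \<open>Boundedness of the sublevel sets\<close>

lemma matrix_entry: "(M *v axis j 1) $ i = M $ i $ j" for M :: "real^'n^'m"
  by (simp add: matrix_vector_mult_basis column_def)

lemma norm_matrix_le:
  fixes M :: "real^'n^'m"
  assumes "\<And>i j. \<bar>M $ i $ j\<bar> \<le> c"
  shows "norm M \<le> real CARD('m) * (real CARD('n) * c)"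
proof -
  have "norm (M $ i) \<le> real CARD('n) * c" for i
  proof -
    have "norm (M $ i) \<le> (\<Sum>j\<in>UNIV. \<bar>M $ i $ j\<bar>)" by (rule norm_le_l1_cart)
    also have "\<dots> \<le> (\<Sum>j\<in>(UNIV :: 'n set). c)" using assms by (intro sum_mono) auto
    finally show ?thesis by simp
  qed
  moreover have "norm M \<le> (\<Sum>i\<in>UNIV. norm (M $ i))"
    unfolding norm_vec_def by (intro L2_set_le_sum) auto
  ultimately have "norm M \<le> (\<Sum>i\<in>(UNIV :: 'm set). real CARD('n) * c)"
    by (meson order_trans sum_mono)
  then show ?thesis by simp
qed

text \<open>The constant is the smallest eigenvalue of \<open>R\<close>, obtained as minus the
  largest eigenvalue of \<open>- R\<close>.\<close>

lemma pos_def_coercive: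
  fixes R :: "real^'n^'n"
  assumes "pos_def R"
  obtains r where "0 < r" "\<And>u. r * (norm u)\<^sup>2 \<le> u \<bullet> (R *v u)"
proof -
  from assms have sym: "transpose R = R" and pos: "\<And>x. x \<noteq> 0 \<Longrightarrow> 0 < x \<bullet> (R *v x)"
    by (auto simp: pos_def_def)
  have neg: "transpose (- R) = - R" using sym by (simp add: vec_eq_iff transpose_def)
  have mv: "(- R) *v x = - (R *v x)" for x
    by (simp add: vec_eq_iff matrix_vector_mult_def sum_negf)
  have "(UNIV :: (real^'n) set) \<noteq> {0}"
    by (metis UNIV_I norm_axis_1 norm_zero singletonD zero_neq_one)
  then obtain e where "norm e = 1" "\<And>x. x \<bullet> (- R *v x) \<le> (e \<bullet> (- R *v e)) * (norm x)\<^sup>2"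
    using symmetric_eigenvector[OF neg subspace_UNIV] by (metis UNIV_I)
  then have "e \<noteq> 0" "(e \<bullet> (R *v e)) * (norm u)\<^sup>2 \<le> u \<bullet> (R *v u)" for u
    by (auto simp: mv)
  then show thesis using that[of "e \<bullet> (R *v e)"] pos by blast
qed

text \<open>Nonnegativity at the sum and the difference of two basis vectors bounds twice an entry
  by the sum of two diagonal entries, each at most \<open>c\<close>.\<close>

lemma psd_entry_le:
  fixes P :: "real^'d^'d"
  assumes sym: "transpose P = P" and pos: "\<And>x. 0 \<le> x \<bullet> (P *v x)"
    and le: "\<And>x. x \<bullet> (P *v x) \<le> c * (x \<bullet> x)"
  shows "\<bar>P $ i $ j\<bar> \<le> c"
proof -
  let ?x = "axis i 1 :: real^'d" and ?y = "axis j 1 :: real^'d"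
  have e: "P $ i $ j = ?x \<bullet> (P *v ?y)"
    by (metis inner_axis' inner_real_def matrix_entry mult_1)
  have s: "?y \<bullet> (P *v ?x) = ?x \<bullet> (P *v ?y)"
    using symmetric_inner[OF sym, of ?x ?y] by (simp add: inner_commute)
  have xx: "?x \<bullet> (P *v ?x) \<le> c" "?y \<bullet> (P *v ?y) \<le> c"
    using le[of ?x] le[of ?y] by (simp_all add: inner_axis_axis)
  have "0 \<le> ?x \<bullet> (P *v ?x) + 2 * (?x \<bullet> (P *v ?y)) + ?y \<bullet> (P *v ?y)"
    "0 \<le> ?x \<bullet> (P *v ?x) - 2 * (?x \<bullet> (P *v ?y)) + ?y \<bullet> (P *v ?y)"
    using pos[of "?x + ?y"] pos[of "?x - ?y"] s
    by (simp_all add: matrix_vector_right_distrib matrix_vector_mult_diff_distrib inner_add_left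
        inner_add_right inner_diff_left inner_diff_right del: matrix_vector_mult_basis)
  then show ?thesis using xx unfolding e by linarith
qed

context
  fixes A :: "'t::{finite,linorder} \<Rightarrow> real^'n::finite^'n"
    and B :: "'t \<Rightarrow> real^'m::finite^'n" and C :: "'t \<Rightarrow> real^'n^'p::finite"
    and Q :: "real^('t \<times> 'n)^('t \<times> 'n)" and R :: "real^('t \<times> 'm)^('t \<times> 'm)"
    and \<xi> :: "'k::finite \<Rightarrow> real^(('t \<times> 'n) + ('t \<times> 'p))"
    and \<rho> :: real
  assumes Q: "psd Q" and R: "pos_def R" and \<rho>: "0 < \<rho>"
begin

lemma psd_S: "psd (block_mat Q 0 0 R)"
  by (rule psd_block_diag[OF Q pos_def_imp_psd[OF R]])

text \<open>The first matrix inequality is tested at \<open>t = 0\<close> for the bound by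
  \<open>l\<close> and at \<open>t = -1\<close> for the pointwise dual constraint.\<close>

lemma sdp_feasible_quadratic:
  assumes "(l, s, \<nu>, P, X, Y, U, V) \<in> sdp_feasible A B C Q R \<xi>"
  shows "0 \<le> x \<bullet> (P *v x)" "x \<bullet> (P *v x) \<le> l * (x \<bullet> x)"
    "x \<bullet> (P *v x) \<le> s $ k + \<nu> \<bullet> x + l * (norm (x - centered \<xi> k))\<^sup>2"
proof -
  note f = assms[unfolded sdp_feasible_iff_schur]
  have lmi: "0 \<le> l * (x \<bullet> x) - x \<bullet> (P *v x) + 2 * t * (x \<bullet> (- (1/2) *\<^sub>R \<nu> + l *\<^sub>R centered \<xi> k)) +
      t\<^sup>2 * (s $ k + l * (norm (centered \<xi> k))\<^sup>2)" for k t
    using f by blast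
  show "0 \<le> x \<bullet> (P *v x)"
    using f by (meson inner_ge_zero order_trans)
  show "x \<bullet> (P *v x) \<le> l * (x \<bullet> x)"
    using lmi[of 0] by simp
  show "x \<bullet> (P *v x) \<le> s $ k + \<nu> \<bullet> x + l * (norm (x - centered \<xi> k))\<^sup>2"
    using lmi[of "-1" k]
    by (simp add: power2_norm_eq_inner inner_diff_left inner_diff_right inner_add_right
        inner_commute algebra_simps)
qed

text \<open>At a sample the transport term vanishes, which leaves a lower bound linear in that
  sample; summed over all samples it cancels by centering. So the objective is at least
  \<open>l * \<rho>\<^sup>2\<close>.\<close>

lemma sdp_feasible_multiplier_sum:
  assumes z: "(l, s, \<nu>, P, X, Y, U, V) \<in> sdp_feasible A B C Q R \<xi>"
  shows "0 \<le> (\<Sum>k\<in>UNIV. s $ k)"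
proof -
  have "- (\<nu> \<bullet> centered \<xi> k) \<le> s $ k" for k
    using sdp_feasible_quadratic(1)[OF z, of "centered \<xi> k"]
      sdp_feasible_quadratic(3)[OF z, of "centered \<xi> k" k] by simp
  then have "(\<Sum>k\<in>UNIV. - (\<nu> \<bullet> centered \<xi> k)) \<le> (\<Sum>k\<in>UNIV. s $ k)"
    by (intro sum_mono)
  moreover have "(\<Sum>k\<in>UNIV. - (\<nu> \<bullet> centered \<xi> k)) = 0"
    by (simp add: sum_negf inner_sum_right[symmetric] sum_centered)
  ultimately show ?thesis by simp
qed

text \<open>The bounds come in order: \<open>l\<close> from the objective, then \<open>\<nu>\<close>
  by testing the dual constraint against its direction, then \<open>s\<close> from below at the
  samples and from above through its bounded sum.\<close>

lemma sdp_sublevel_multiplier_bounds: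
  assumes z: "(l, s, \<nu>, P, X, Y, U, V) \<in> sdp_feasible A B C Q R \<xi>"
    and v: "sdp_objective \<rho> (l, s, \<nu>, P, X, Y, U, V) \<le> v"
  defines "b \<equiv> v + v / \<rho>\<^sup>2 * (\<Sum>k\<in>UNIV. (1 + norm (centered \<xi> k))\<^sup>2)"
  shows "0 \<le> l" "l \<le> v / \<rho>\<^sup>2" "norm \<nu> \<le> b"
    "norm s \<le> real CARD('k) * (real CARD('k) * (v + b * (\<Sum>k\<in>UNIV. norm (centered \<xi> k))))"
proof -
  let ?N = "real CARD('k)" and ?c = "centered \<xi>"
  note quad = sdp_feasible_quadratic[OF z]
  have N: "1 \<le> ?N" by (simp add: Suc_leI)
  show l: "0 \<le> l" using z by (simp add: sdp_feasible_iff)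
  have obj: "l * \<rho>\<^sup>2 + (\<Sum>k\<in>UNIV. s $ k) / ?N \<le> v"
    using v by (simp add: sdp_objective_def)
  have s0: "0 \<le> (\<Sum>k\<in>UNIV. s $ k) / ?N"
    using sdp_feasible_multiplier_sum[OF z] by simp
  have "l * \<rho>\<^sup>2 \<le> v" using obj s0 by linarith
  then show lv: "l \<le> v / \<rho>\<^sup>2" using \<rho> by (simp add: field_simps)
  have "0 \<le> l * \<rho>\<^sup>2" using l by simp
  then have v0: "0 \<le> v" and sv: "(\<Sum>k\<in>UNIV. s $ k) / ?N \<le> v" using obj s0 by linarith+
  have "0 \<le> b" unfolding b_def using v0 by (auto intro!: add_nonneg_nonneg divide_nonneg_nonneg mult_nonneg_nonneg sum_nonneg)
  \<comment> \<open>The unit vector opposite to \<open>\<nu>\<close>, or 0 when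
    \<open>\<nu> = 0\<close>; in both cases \<open>\<nu> \<bullet> x = - norm \<nu>\<close>.\<close>
  define x where "x = - sgn \<nu>"
  have x: "\<nu> \<bullet> x = - norm \<nu>" "norm x \<le> 1"
    by (auto simp: x_def norm_sgn sgn_div_norm dot_square_norm power2_eq_square divide_simps)
  have "norm \<nu> \<le> s $ k + v / \<rho>\<^sup>2 * (1 + norm (?c k))\<^sup>2" for k
  proof -
    have "norm (x - ?c k) \<le> 1 + norm (?c k)" using norm_triangle_ineq4[of x "?c k"] x by linarith
    then have "l * (norm (x - ?c k))\<^sup>2 \<le> v / \<rho>\<^sup>2 * (1 + norm (?c k))\<^sup>2"
      using l lv by (intro mult_mono power_mono) auto
    then show ?thesis using quad(1)[of x] quad(3)[of x k] x by linarith
  qed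
  then have "(\<Sum>k\<in>(UNIV :: 'k set). norm \<nu>) \<le> (\<Sum>k\<in>UNIV. s $ k + v / \<rho>\<^sup>2 * (1 + norm (?c k))\<^sup>2)"
    by (intro sum_mono)
  then have "?N * norm \<nu> \<le> (\<Sum>k\<in>UNIV. s $ k) + v / \<rho>\<^sup>2 * (\<Sum>k\<in>UNIV. (1 + norm (?c k))\<^sup>2)"
    by (simp add: sum.distrib sum_distrib_left)
  also have "\<dots> \<le> ?N * v + ?N * (v / \<rho>\<^sup>2 * (\<Sum>k\<in>UNIV. (1 + norm (?c k))\<^sup>2))"
  proof (rule add_mono)
    show "(\<Sum>k\<in>UNIV. s $ k) \<le> ?N * v" using sv N by (simp add: field_simps)
    have "0 \<le> v / \<rho>\<^sup>2 * (\<Sum>k\<in>UNIV. (1 + norm (?c k))\<^sup>2)"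
      using v0 by (auto intro!: divide_nonneg_nonneg mult_nonneg_nonneg sum_nonneg)
    from mult_right_mono[OF N this]
    show "v / \<rho>\<^sup>2 * (\<Sum>k\<in>UNIV. (1 + norm (?c k))\<^sup>2) \<le> ?N * (v / \<rho>\<^sup>2 * (\<Sum>k\<in>UNIV. (1 + norm (?c k))\<^sup>2))"
      by (simp only: mult_1)
  qed
  also have "\<dots> = ?N * b" by (simp add: b_def distrib_left)
  finally show \<nu>: "norm \<nu> \<le> b" using N by simp
  define \<Xi> where "\<Xi> = (\<Sum>k\<in>UNIV. norm (?c k))"
  have \<Xi>: "norm (?c k) \<le> \<Xi>" for k
    unfolding \<Xi>_def by (intro member_le_sum) auto
  have \<Xi>0: "0 \<le> \<Xi>" unfolding \<Xi>_def by (intro sum_nonneg) auto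
  have low: "- (b * \<Xi>) \<le> s $ k" for k
  proof -
    have "\<nu> \<bullet> ?c k \<le> norm \<nu> * norm (?c k)" by (rule norm_cauchy_schwarz)
    also have "\<dots> \<le> b * \<Xi>" using \<nu> \<Xi>[of k] \<open>0 \<le> b\<close> by (intro mult_mono) auto
    finally show ?thesis using quad(1)[of "?c k"] quad(3)[of "?c k" k] by simp
  qed
  have high: "s $ k \<le> ?N * (v + b * \<Xi>)" for k
  proof -
    \<comment> \<open>Shifted by the lower bound, all multipliers are nonnegative, so each one is at
      most their sum.\<close>
    have "0 \<le> s $ j + b * \<Xi>" for j
      using low[of j] by linarith
    then have "s $ k + b * \<Xi> \<le> (\<Sum>j\<in>UNIV. s $ j + b * \<Xi>)"
      by (intro member_le_sum) simp_all
    also have "\<dots> \<le> ?N * v + ?N * (b * \<Xi>)"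
      using sv N by (simp add: sum.distrib field_simps)
    finally have "s $ k + b * \<Xi> \<le> ?N * (v + b * \<Xi>)" by (simp add: distrib_left)
    moreover have "0 \<le> b * \<Xi>" using \<open>0 \<le> b\<close> \<Xi>0 by simp
    ultimately show ?thesis by linarith
  qed
  have "\<bar>s $ k\<bar> \<le> ?N * (v + b * \<Xi>)" for k
  proof -
    have "b * \<Xi> \<le> ?N * (v + b * \<Xi>)"
      using N v0 \<open>0 \<le> b\<close> \<Xi>0 mult_mono[of 1 ?N "b * \<Xi>" "v + b * \<Xi>"] by simp
    then show ?thesis using low[of k] high[of k] by linarith
  qed
  then have "(\<Sum>k\<in>UNIV. \<bar>s $ k\<bar>) \<le> (\<Sum>k\<in>(UNIV :: 'k set). ?N * (v + b * \<Xi>))"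
    by (intro sum_mono)
  then show "norm s \<le> ?N * (?N * (v + b * (\<Sum>k\<in>UNIV. norm (?c k))))"
    using norm_le_l1_cart[of s] by (simp add: \<Xi>_def)
qed

text \<open>For a unit disturbance the input \<open>u\<close> satisfies
  \<open>r * (norm u)\<^sup>2 \<le> l\<close>, through the running cost, \<open>F\<close> and
  \<open>P\<close>. Basis vectors as disturbances then bound the entries of \<open>U\<close> and
  \<open>V\<close>.\<close>

lemma sdp_feasible_input_response:
  assumes z: "(l, s, \<nu>, P, X, Y, U, V) \<in> sdp_feasible A B C Q R \<xi>"
    and r: "0 < r" "\<And>u. r * (norm u)\<^sup>2 \<le> u \<bullet> (R *v u)" and l: "l \<le> L"
  shows "norm U \<le> real CARD('t \<times> 'm) * (real CARD('t \<times> 'n) * sqrt (L / r))"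
    "norm V \<le> real CARD('t \<times> 'm) * (real CARD('t \<times> 'p) * sqrt (L / r))"
proof -
  define F where "F = psd_sqrt (block_mat Q 0 0 R) ** block_mat X Y U V"
  have F: "(F *v y) \<bullet> (F *v y) \<le> y \<bullet> (P *v y)" for y
    using z unfolding sdp_feasible_iff_schur F_def by blast
  have bound: "norm (U *v w + V *v v) \<le> sqrt (L / r)" if wv: "vjoin w v \<bullet> vjoin w v = 1" for w v
  proof -
    let ?x = "X *v w + Y *v v" and ?u = "U *v w + V *v v"
    have "r * (norm ?u)\<^sup>2 \<le> ?x \<bullet> (Q *v ?x) + ?u \<bullet> (R *v ?u)"
      using r(2)[of ?u] Q by (simp add: psd_def add_increasing)
    also have "\<dots> = (F *v vjoin w v) \<bullet> (F *v vjoin w v)"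
      unfolding F_def
      by (simp only: matrix_vector_mul_assoc[symmetric] psd_sqrt_inner[OF psd_S] block_mat_vjoin inner_vjoin
         matrix_vector_mult_0 add_0_left add_0_right)
    also have "\<dots> \<le> l * 1"
      using F[of "vjoin w v"] sdp_feasible_quadratic(2)[OF z, of "vjoin w v"] wv by simp
    finally have "(norm ?u)\<^sup>2 \<le> L / r" using r l by (simp add: field_simps)
    then show ?thesis by (rule real_le_rsqrt)
  qed
  have "\<bar>U $ i $ j\<bar> \<le> sqrt (L / r)" for i j
    using bound[of "axis j 1" 0] component_le_norm_cart[of "U *v axis j 1" i]
    by (simp add: inner_vjoin inner_axis_axis matrix_entry del: matrix_vector_mult_basis)
  then show "norm U \<le> real CARD('t \<times> 'm) * (real CARD('t \<times> 'n) * sqrt (L / r))"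
    by (rule norm_matrix_le)
  have "\<bar>V $ i $ j\<bar> \<le> sqrt (L / r)" for i j
    using bound[of 0 "axis j 1"] component_le_norm_cart[of "V *v axis j 1" i]
    by (simp add: inner_vjoin inner_axis_axis matrix_entry del: matrix_vector_mult_basis)
  then show "norm V \<le> real CARD('t \<times> 'm) * (real CARD('t \<times> 'p) * sqrt (L / r))"
    by (rule norm_matrix_le)
qed

text \<open>\<open>Q\<close> may be singular, so the cost does not bound the state responses
  directly. They are recovered from \<open>U\<close> and \<open>V\<close> through the dynamics, as
  continuous images of balls.\<close>

lemma bounded_sdp_sublevel:
  "bounded {z \<in> sdp_feasible A B C Q R \<xi>. sdp_objective \<rho> z \<le> v}"
proof -
  define L where "L = v / \<rho>\<^sup>2"
  define b where "b = v + v / \<rho>\<^sup>2 * (\<Sum>k\<in>UNIV. (1 + norm (centered \<xi> k))\<^sup>2)"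
  define bs where "bs = real CARD('k) * (real CARD('k) * (v + b * (\<Sum>k\<in>UNIV. norm (centered \<xi> k))))"
  obtain r where r: "0 < r" "\<And>u. r * (norm u)\<^sup>2 \<le> u \<bullet> (R *v u)"
    using pos_def_coercive[OF R] by blast
  define bU where "bU = real CARD('t \<times> 'm) * (real CARD('t \<times> 'n) * sqrt (L / r))"
  define bV where "bV = real CARD('t \<times> 'm) * (real CARD('t \<times> 'p) * sqrt (L / r))"
  define bP where "bP = real CARD(('t \<times> 'n) + ('t \<times> 'p)) * (real CARD(('t \<times> 'n) + ('t \<times> 'p)) * L)"
  let ?ZA = "downshift ** blkdiag A" and ?ZB = "downshift ** blkdiag B"
  have "strictly_causal ?ZA"
    by (intro strictly_causal_mult strictly_causal_downshift causal_blkdiag)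
  then obtain H where H: "H ** (mat 1 - ?ZA) = mat 1"
    by (rule strictly_causal_inverse)
  define fX where "fX U = H ** (mat 1 + ?ZB ** U)" for U :: "real^('t \<times> 'n)^('t \<times> 'm)"
  define fY where "fY V = H ** (?ZB ** V)" for V :: "real^('t \<times> 'p)^('t \<times> 'm)"
  have bdd: "bounded (fX ` cball 0 bU)" "bounded (fY ` cball 0 bV)"
    unfolding fX_def fY_def
    by (intro compact_imp_bounded compact_continuous_image continuous_intros compact_cball)+
  let ?D = "cball 0 L \<times> cball 0 bs \<times> cball 0 b \<times> cball 0 bP \<times> fX ` cball 0 bU \<times> fY ` cball 0 bV \<times>
    cball 0 bU \<times> cball 0 bV"
  have "bounded ?D"
    by (intro bounded_Times bounded_cball bdd)
  moreover have "{z \<in> sdp_feasible A B C Q R \<xi>. sdp_objective \<rho> z \<le> v} \<subseteq> ?D"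
  proof
    fix z assume "z \<in> {z \<in> sdp_feasible A B C Q R \<xi>. sdp_objective \<rho> z \<le> v}"
    moreover obtain l s \<nu> P X Y U V where eq: "z = (l, s, \<nu>, P, X, Y, U, V)" by (rule prod_cases8)
    ultimately have z: "(l, s, \<nu>, P, X, Y, U, V) \<in> sdp_feasible A B C Q R \<xi>"
      and v: "sdp_objective \<rho> (l, s, \<nu>, P, X, Y, U, V) \<le> v" by auto
    note 1 = sdp_sublevel_multiplier_bounds[OF z v, folded L_def b_def, folded bs_def]
    note 2 = sdp_feasible_input_response[OF z r 1(2), folded bU_def bV_def]
    have "x \<bullet> (P *v x) \<le> L * (x \<bullet> x)" for x
      using sdp_feasible_quadratic(2)[OF z, of x] mult_right_mono[OF 1(2), of "x \<bullet> x"] by simp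
    then have "\<bar>P $ i $ j\<bar> \<le> L" for i j
      using z by (intro psd_entry_le sdp_feasible_quadratic(1)[OF z]) (auto simp: sdp_feasible_iff)
    then have P: "norm P \<le> bP" unfolding bP_def by (rule norm_matrix_le)
    have ach: "achievable A B C X Y U V" using z by (simp add: sdp_feasible_iff)
    then have "(mat 1 - ?ZA) ** X = mat 1 + ?ZB ** U" "(mat 1 - ?ZA) ** Y = ?ZB ** V"
      by (auto simp: achievable_iff algebra_simps)
    then have "X = fX U" "Y = fY V"
      unfolding fX_def fY_def by (metis H matrix_mul_assoc matrix_mul_lid)+
    then show "z \<in> ?D"
      using 1 2 P by (auto simp: eq)
  qed
  ultimately show ?thesis by (rule bounded_subset)
qed

text \<open>The program value is at most any worst-case cost, up to \<open>\<epsilon>\<close>: take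
  the responses of \<open>K\<close>, the tight choice \<open>P = F\<^sup>T F\<close>,
  \<open>\<nu> = 0\<close>, and the multipliers from strong duality.\<close>

lemma causal_sdp_value:
  assumes K: "causal K" and \<epsilon>: "0 < \<epsilon>"
  obtains z where "z \<in> sdp_feasible A B C Q R \<xi>"
    "ennreal (sdp_objective \<rho> z) \<le> worst_case_cost A B C Q R \<rho> \<xi> K + ennreal \<epsilon>"
proof -
  obtain X Y U V where ach: "achievable A B C X Y U V"
    and KX: "K ** blkdiag C ** X = U" "K ** blkdiag C ** Y + K = V"
    using causal_achievable[OF K] .
  define F where "F = psd_sqrt (block_mat Q 0 0 R) ** block_mat X Y U V"
  define M where "M = transpose F ** F"
  have MF: "x \<bullet> (M *v y) = (F *v x) \<bullet> (F *v y)" for x y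
    unfolding M_def matrix_vector_mul_assoc[symmetric] inner_transpose by (rule inner_commute)
  have sym: "transpose M = M" by (simp add: M_def matrix_transpose_mul)
  then have "psd M" by (simp add: psd_def MF)
  then obtain l s P where l: "0 \<le> l"
    and lmi: "\<And>k x t. 0 \<le> l * (x \<bullet> x) - x \<bullet> (M *v x) + 2 * t * (x \<bullet> (l *\<^sub>R centered \<xi> k)) +
      t\<^sup>2 * (s k + l * (norm (centered \<xi> k))\<^sup>2)"
    and P: "P \<in> wasserstein_ball \<rho> (centered_empirical \<xi>)"
    and val: "ennreal (l * \<rho>\<^sup>2 + (1 / real CARD('k)) * (\<Sum>k\<in>UNIV. s k)) \<le>
      (\<integral>\<^sup>+x. ennreal (x \<bullet> (M *v x)) \<partial>P) + ennreal \<epsilon>"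
    using wasserstein_strong_duality[OF _ \<rho> \<epsilon>, of M \<xi>] by blast
  let ?z = "(l, \<chi> k. s k, 0, M, X, Y, U, V)"
  have "?z \<in> sdp_feasible A B C Q R \<xi>"
    unfolding sdp_feasible_iff_schur using l lmi sym ach by (auto simp: MF F_def[symmetric])
  moreover have "(\<integral>\<^sup>+x. ennreal (x \<bullet> (M *v x)) \<partial>P) = control_cost A B C Q R K P"
    unfolding MF F_def by (rule closed_loop_cost[OF Q pos_def_imp_psd[OF R] K ach KX, symmetric])
  then have "(\<integral>\<^sup>+x. ennreal (x \<bullet> (M *v x)) \<partial>P) \<le> worst_case_cost A B C Q R \<rho> \<xi> K"
    unfolding worst_case_cost_def using P by (auto intro: SUP_upper)
  then have "ennreal (sdp_objective \<rho> ?z) \<le> worst_case_cost A B C Q R \<rho> \<xi> K + ennreal \<epsilon>"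
    using val add_right_mono order_trans by (fastforce simp: sdp_objective_def)
  ultimately show thesis by (rule that)
qed

text \<open>The zero controller supplies a feasible point, and the continuous objective attains its
  minimum on the compact sublevel set through that point.\<close>

lemma sdp_minimizer_exists:
  "\<exists>z. is_arg_min (sdp_objective \<rho>) (\<lambda>z. z \<in> sdp_feasible A B C Q R \<xi>) z"
proof -
  obtain z0 where z0: "z0 \<in> sdp_feasible A B C Q R \<xi>"
    using causal_sdp_value[OF causal_zero zero_less_one] .
  let ?S = "{z \<in> sdp_feasible A B C Q R \<xi>. sdp_objective \<rho> z \<le> sdp_objective \<rho> z0}"
  have cont: "continuous_on UNIV (sdp_objective \<rho> :: ('t, 'n, 'm, 'p, 'k) sdp_vars \<Rightarrow> real)"
    unfolding sdp_objective_def case_prod_unfold by (intro continuous_intros)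
  have "closed {z :: ('t, 'n, 'm, 'p, 'k) sdp_vars. sdp_objective \<rho> z \<le> sdp_objective \<rho> z0}"
    by (intro closed_Collect_le cont continuous_intros)
  then have "closed ?S"
    using closed_Int[OF closed_sdp_feasible] by (simp add: Collect_conj_eq)
  then have "compact ?S"
    using bounded_sdp_sublevel by (simp add: compact_eq_bounded_closed)
  moreover have "?S \<noteq> {}" using z0 by blast
  ultimately have "\<exists>z\<in>?S. \<forall>y\<in>?S. sdp_objective \<rho> z \<le> sdp_objective \<rho> y"
    by (rule continuous_attains_inf[OF _ _ continuous_on_subset[OF cont subset_UNIV]])
  then obtain z where z: "z \<in> ?S" "\<forall>y\<in>?S. sdp_objective \<rho> z \<le> sdp_objective \<rho> y"
    by (rule bexE)
  have "\<not> sdp_objective \<rho> y < sdp_objective \<rho> z" if y: "y \<in> sdp_feasible A B C Q R \<xi>" for y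
  proof
    assume lt: "sdp_objective \<rho> y < sdp_objective \<rho> z"
    then have "y \<in> ?S" using y z(1) by (simp add: less_imp_le order_less_le_trans)
    then show False using bspec[OF z(2)] lt by (simp add: leD)
  qed
  then have "is_arg_min (sdp_objective \<rho>) (\<lambda>z. z \<in> sdp_feasible A B C Q R \<xi>) z"
    using z(1) unfolding is_arg_min_def by blast
  then show ?thesis ..
qed

text \<open>The cost \<open>(F *v x) \<bullet> (F *v x)\<close> lies below the form of
  \<open>P\<close>, which lies below the dual bound, so weak duality applies to every law in the
  ball.\<close>

lemma sdp_feasible_worst_case:
  assumes z: "(l, s, \<nu>, P, X, Y, U, V) \<in> sdp_feasible A B C Q R \<xi>"
  shows "worst_case_cost A B C Q R \<rho> \<xi> (V - U ** matrix_inv X ** Y) \<le>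
    ennreal (sdp_objective \<rho> (l, s, \<nu>, P, X, Y, U, V))"
  unfolding worst_case_cost_def
proof (rule SUP_least)
  fix D assume D: "D \<in> wasserstein_ball \<rho> (centered_empirical \<xi>)"
  have ach: "achievable A B C X Y U V" and l: "0 \<le> l" using z by (auto simp: sdp_feasible_iff)
  define F where "F = psd_sqrt (block_mat Q 0 0 R) ** block_mat X Y U V"
  have F: "(F *v y) \<bullet> (F *v y) \<le> y \<bullet> (P *v y)" for y
    using z unfolding sdp_feasible_iff_schur F_def by blast
  note K = achievable_controller[OF ach]
  have "control_cost A B C Q R (V - U ** matrix_inv X ** Y) D = (\<integral>\<^sup>+x. ennreal ((F *v x) \<bullet> (F *v x)) \<partial>D)"
    unfolding F_def by (rule closed_loop_cost[OF Q pos_def_imp_psd[OF R] K(2) ach K(3,4)])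
  also have "\<dots> \<le> ennreal (l * \<rho>\<^sup>2 + (1 / real CARD('k)) * (\<Sum>k\<in>UNIV. s $ k))"
  proof (rule wasserstein_weak_duality[OF D \<rho> l])
    show "(\<lambda>x. (F *v x) \<bullet> (F *v x)) \<in> borel_measurable borel"
      by (intro borel_measurable_continuous_onI continuous_intros)
    show "(F *v x) \<bullet> (F *v x) \<le> s $ k + \<nu> \<bullet> x + l * (norm (x - centered \<xi> k))\<^sup>2" for k x
      using F sdp_feasible_quadratic(3)[OF z] order_trans by blast
  qed simp
  finally show "control_cost A B C Q R (V - U ** matrix_inv X ** Y) D \<le>
      ennreal (sdp_objective \<rho> (l, s, \<nu>, P, X, Y, U, V))"
    by (simp add: sdp_objective_def)
qed

end

theorem theorem2:
  fixes A :: "'t::{finite,linorder} \<Rightarrow> real^'n::finite^'n"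
    and B :: "'t \<Rightarrow> real^'m::finite^'n"
    and C :: "'t \<Rightarrow> real^'n^'p::finite"
    and Q :: "real^('t \<times> 'n)^('t \<times> 'n)"
    and R :: "real^('t \<times> 'm)^('t \<times> 'm)"
    and \<xi> :: "'k::finite \<Rightarrow> real^(('t \<times> 'n) + ('t \<times> 'p))"
    and \<rho> :: real
  assumes "psd Q" and "pos_def R" and "\<rho> > 0"
  shows "convex_on (sdp_feasible A B C Q R \<xi>) (sdp_objective \<rho>) \<and>
    (\<exists>z. is_arg_min (sdp_objective \<rho>) (\<lambda>z. z \<in> sdp_feasible A B C Q R \<xi>) z) \<and>
    (\<forall>l s \<nu> P \<Phi>xx \<Phi>xy \<Phi>ux \<Phi>uy.
      is_arg_min (sdp_objective \<rho>) (\<lambda>z. z \<in> sdp_feasible A B C Q R \<xi>)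
        (l, s, \<nu>, P, \<Phi>xx, \<Phi>xy, \<Phi>ux, \<Phi>uy) \<longrightarrow>
      invertible \<Phi>xx \<and>
      is_arg_min (worst_case_cost A B C Q R \<rho> \<xi>) causal
        (\<Phi>uy - \<Phi>ux ** matrix_inv \<Phi>xx ** \<Phi>xy))"
proof (intro conjI allI impI)
  show "convex_on (sdp_feasible A B C Q R \<xi>) (sdp_objective \<rho>)"
    by (rule convex_on_sdp_objective)
  show "\<exists>z. is_arg_min (sdp_objective \<rho>) (\<lambda>z. z \<in> sdp_feasible A B C Q R \<xi>) z"
    using sdp_minimizer_exists[OF assms] .
next
  fix l s \<nu> P \<Phi>xx \<Phi>xy \<Phi>ux \<Phi>uy
  assume "is_arg_min (sdp_objective \<rho>) (\<lambda>z. z \<in> sdp_feasible A B C Q R \<xi>)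
    (l, s, \<nu>, P, \<Phi>xx, \<Phi>xy, \<Phi>ux, \<Phi>uy)"
    (is "is_arg_min _ _ ?z")
  let ?K = "\<Phi>uy - \<Phi>ux ** matrix_inv \<Phi>xx ** \<Phi>xy"
  from \<open>is_arg_min _ _ ?z\<close> have z: "?z \<in> sdp_feasible A B C Q R \<xi>"
    and min: "\<And>y. y \<in> sdp_feasible A B C Q R \<xi> \<Longrightarrow> sdp_objective \<rho> ?z \<le> sdp_objective \<rho> y"
    by (auto simp: is_arg_min_def not_less)
  have ach: "achievable A B C \<Phi>xx \<Phi>xy \<Phi>ux \<Phi>uy" using z by (simp add: sdp_feasible_iff)
  show "invertible \<Phi>xx" using achievable_controller(1)[OF ach] .
  \<comment> \<open>The optimal program value separates the two sides: it is at least the worst-case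
    cost of \<open>?K\<close> and at most that of every causal \<open>K\<close>.\<close>
  have "worst_case_cost A B C Q R \<rho> \<xi> ?K \<le> worst_case_cost A B C Q R \<rho> \<xi> K" if "causal K" for K
  proof -
    have "ennreal (sdp_objective \<rho> ?z) \<le> worst_case_cost A B C Q R \<rho> \<xi> K"
    proof (rule ennreal_le_epsilon)
      fix e :: real assume "0 < e"
      then obtain y where "y \<in> sdp_feasible A B C Q R \<xi>"
        "ennreal (sdp_objective \<rho> y) \<le> worst_case_cost A B C Q R \<rho> \<xi> K + ennreal e"
        using causal_sdp_value[OF assms \<open>causal K\<close>] by metis
      then show "ennreal (sdp_objective \<rho> ?z) \<le> worst_case_cost A B C Q R \<rho> \<xi> K + ennreal e"
        using min ennreal_leI order_trans by blast
    qed
    then show ?thesis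
      using sdp_feasible_worst_case[OF assms z] by (rule order_trans[rotated])
  qed
  then show "is_arg_min (worst_case_cost A B C Q R \<rho> \<xi>) causal ?K"
    using achievable_controller(2)[OF ach] by (auto simp: is_arg_min_def not_less)
qed

end
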